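(* Set $n=t+2$ and let $X$ be uniform on the $2^n$ vertices of the attainable cube $Q_t=(5/8,0,\ldots,0)+[-1/8,1/8]^{n}$. Consider any possibly randomized memory $Z$ satisfying $I(X;Z)\le B$ bits and any decoder $\widehat X(Z)$. Then $$\frac1n\,\mathbb E\|\widehat X-X\|_1\ \ge\ \frac18\,h_2^{-1}\!\left(\left[1-\frac Bn\right]_+\right).$$ The same right-hand side without the factor $1/8$ lower-bounds the average error probability across the $n$ coordinate-threshold decisions. Consequently, if a $d$-coordinate implementation stores at most $b>0$ bits per coordinate, average decision error at most $\eta<1/2$ requires $$d\ge\frac{(t+2)\{1-h_2(\eta)\}}{b}.$$ For every encoder–decoder pair, its worst conditional risk over $Q_t$ is at least its risk under this uniform distribution. Hence the same right-hand side is also a minimax lower bound on this attainable subclass. Under these continuity and finite-information criteria (the continuity criterion being the one recalled in the context), linear vintage memory is required both for uniform recovery and for randomized average-case/minimax representation.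
   Context: Here $t\ge1$ is a date. The cube $Q_t\subset\mathbb R^{t+2}$ is attainable in the following sense: there is a finite one-decision model at date $t$ with bounded rewards such that every point of $Q_t$ equals $(P;V_0,\dots,V_t)$ for some admissible reward system and pure subgame-perfect policy, where $V_s$ is the robust (worst-case expected) value of that policy under the ambiguity set of evaluator vintage $s$ ($0\le s\le t$) and $P$ is vintage $0$'s optimal precommitment value. A "vintage memory" is a representation of such a vector. $I(X;Z)$ is mutual information in bits. $h_2(q)=-q\log_2q-(1-q)\log_2(1-q)$ for $q\in[0,1/2]$, and $h_2^{-1}:[0,1]\to[0,1/2]$ is its inverse; $[x]_+=\max\{x,0\}$. A randomized memory (encoder) is a random variable $Z$ generated from $X$ by a Markov kernel; a decoder is a function of $Z$. The $i$-th coordinate-threshold decision is to decide from $Z$ whether $X_i$ lies above or below the $i$-th coordinate of the center $(5/8,0,\ldots,0)$; the average error probability is the mean over $i=1,\dots,n$ of the error probabilities. A $d$-coordinate implementation storing at most $b$ bits per coordinate has $H(Z)\le bd$. Conditional risk at $x\in Q_t$ is the expected loss given $X=x$. The finite-information criterion is the constraint $I(X;Z)\le B$ above. The continuity criterion is that of the companion result for deterministic codes: the encoder is a continuous map $E:Q_t\to\mathbb R^d$ and the decoder $D:\mathbb R^d\to\mathbb R^{t+2}$ is arbitrary; for it, $d<t+2$ forces $\sup_{x\in Q_t}\|D(E(x))-x\|_\infty\ge1/8$, so uniform recovery (exact, or with uniform error strictly below $1/8$) requires $d\ge t+2$. "Linear vintage memory" means a memory whose size grows linearly in $t$. *)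

theory Defs
  imports "HOL-Probability.Probability"
begin

text \<open>
  Points of real n-space are functions \<open>nat \<Rightarrow> real\<close> vanishing at all indices \<open>i \<ge> n\<close>, as in the
  library's \<^const>\<open>Euclidean_space\<close>; coordinates are numbered from 0. For the vectors
  \<open>(P; V\<^sub>0, \<dots>, V\<^sub>t)\<close> of length \<open>t + 2\<close>, coordinate 0 is \<open>P\<close> and coordinate \<open>s + 1\<close> is \<open>V\<^sub>s\<close>.
\<close>

definition center :: "nat \<Rightarrow> real" where
  "center i = (if i = 0 then 5/8 else 0)"

definition cube :: "nat \<Rightarrow> (nat \<Rightarrow> real) set" where
  "cube t = {x. (\<forall>i<t+2. \<bar>x i - center i\<bar> \<le> 1/8) \<and> (\<forall>i\<ge>t+2. x i = 0)}"

definition vertices :: "nat \<Rightarrow> (nat \<Rightarrow> real) set" where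
  "vertices t = {x. (\<forall>i<t+2. \<bar>x i - center i\<bar> = 1/8) \<and> (\<forall>i\<ge>t+2. x i = 0)}"

definition l1_dist :: "nat \<Rightarrow> (nat \<Rightarrow> real) \<Rightarrow> (nat \<Rightarrow> real) \<Rightarrow> real" where
  "l1_dist n x y = (\<Sum>i<n. \<bar>x i - y i\<bar>)"

definition linf_dist :: "nat \<Rightarrow> (nat \<Rightarrow> real) \<Rightarrow> (nat \<Rightarrow> real) \<Rightarrow> real" where
  "linf_dist n x y = Max ((\<lambda>i. \<bar>x i - y i\<bar>) ` {..<n})"


subsection \<open>Attainable value vectors\<close>

text \<open>
  A one-decision model at date \<open>t\<close>: a single action from the finite set \<open>A\<close> is taken at date \<open>t\<close>,
  after which an outcome in the finite set \<open>\<Omega>\<close> realizes. The evaluator of vintage \<open>s\<close> has the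
  ambiguity set \<open>\<P> s\<close> of outcome distributions. A pure policy is an element of \<open>A\<close>, and the only
  decision node belongs to vintage \<open>t\<close>, so subgame perfection is optimality for vintage \<open>t\<close>.
\<close>

definition one_decision_model ::
    "nat \<Rightarrow> nat set \<Rightarrow> nat set \<Rightarrow> (nat \<Rightarrow> nat pmf set) \<Rightarrow> bool" where
  "one_decision_model t A \<Omega> \<P> \<longleftrightarrow>
     finite A \<and> A \<noteq> {} \<and> finite \<Omega> \<and> \<Omega> \<noteq> {} \<and>
     (\<forall>s\<le>t. \<P> s \<noteq> {} \<and> (\<forall>p\<in>\<P> s. set_pmf p \<subseteq> \<Omega>))"

definition admissible_reward :: "nat set \<Rightarrow> nat set \<Rightarrow> real \<Rightarrow> (nat \<Rightarrow> nat \<Rightarrow> real) \<Rightarrow> bool" where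
  "admissible_reward A \<Omega> R r \<longleftrightarrow> (\<forall>a\<in>A. \<forall>\<omega>\<in>\<Omega>. \<bar>r a \<omega>\<bar> \<le> R)"

definition robust_value ::
    "(nat \<Rightarrow> nat pmf set) \<Rightarrow> (nat \<Rightarrow> nat \<Rightarrow> real) \<Rightarrow> nat \<Rightarrow> nat \<Rightarrow> real" where
  "robust_value \<P> r s a = (INF p\<in>\<P> s. measure_pmf.expectation p (r a))"

definition subgame_perfect ::
    "nat \<Rightarrow> nat set \<Rightarrow> (nat \<Rightarrow> nat pmf set) \<Rightarrow> (nat \<Rightarrow> nat \<Rightarrow> real) \<Rightarrow> nat \<Rightarrow> bool" where
  "subgame_perfect t A \<P> r a \<longleftrightarrow>
     a \<in> A \<and> (\<forall>a'\<in>A. robust_value \<P> r t a' \<le> robust_value \<P> r t a)"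

definition precommitment_value ::
    "nat set \<Rightarrow> (nat \<Rightarrow> nat pmf set) \<Rightarrow> (nat \<Rightarrow> nat \<Rightarrow> real) \<Rightarrow> real" where
  "precommitment_value A \<P> r = Max (robust_value \<P> r 0 ` A)"

definition value_vector ::
    "nat \<Rightarrow> nat set \<Rightarrow> (nat \<Rightarrow> nat pmf set) \<Rightarrow> (nat \<Rightarrow> nat \<Rightarrow> real) \<Rightarrow> nat \<Rightarrow> nat \<Rightarrow> real" where
  "value_vector t A \<P> r a i =
     (if i = 0 then precommitment_value A \<P> r
      else if i \<le> t + 1 then robust_value \<P> r (i - 1) a else 0)"

definition attainable_vectors ::
    "nat \<Rightarrow> nat set \<Rightarrow> nat set \<Rightarrow> (nat \<Rightarrow> nat pmf set) \<Rightarrow> real \<Rightarrow> (nat \<Rightarrow> real) set" where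
  "attainable_vectors t A \<Omega> \<P> R =
     {value_vector t A \<P> r a | r a. admissible_reward A \<Omega> R r \<and> subgame_perfect t A \<P> r a}"


subsection \<open>Binary entropy function\<close>

definition h2 :: "real \<Rightarrow> real" where
  "h2 q = - q * log 2 q - (1 - q) * log 2 (1 - q)"

definition h2_inv :: "real \<Rightarrow> real" where
  "h2_inv = the_inv_into {0..1/2} h2"


subsection \<open>Randomized memories\<close>

text \<open>
  An encoder is a Markov kernel from the cube to the memory space \<open>N\<close>. Under \<open>joint_law t N K\<close>
  the pair \<open>(X, Z) = (fst, snd)\<close> has \<open>X\<close> uniform on the vertices and \<open>Z\<close> generated from \<open>X\<close> by
  \<open>K\<close>. All quantities below depend on \<open>(X, Z)\<close> only through this law.
\<close>

definition encoder :: "nat \<Rightarrow> 'z measure \<Rightarrow> ((nat \<Rightarrow> real) \<Rightarrow> 'z measure) \<Rightarrow> bool" where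
  "encoder t N K \<longleftrightarrow> K \<in> restrict_space borel (cube t) \<rightarrow>\<^sub>M prob_algebra N"

definition joint_law ::
    "nat \<Rightarrow> 'z measure \<Rightarrow> ((nat \<Rightarrow> real) \<Rightarrow> 'z measure) \<Rightarrow> ((nat \<Rightarrow> real) \<times> 'z) measure" where
  "joint_law t N K =
     uniform_count_measure (vertices t) \<bind>
       (\<lambda>x. distr (K x) (count_space (vertices t) \<Otimes>\<^sub>M N) (Pair x))"

text \<open>
  \<open>I(X;Z)\<close> in bits. The library integral is not a junk value here: \<open>X\<close> takes finitely many values,
  so the joint law has a density bounded by \<open>2 ^ (t + 2)\<close> with respect to the product law.
\<close>

definition memory_information ::
    "nat \<Rightarrow> 'z measure \<Rightarrow> ((nat \<Rightarrow> real) \<Rightarrow> 'z measure) \<Rightarrow> real" where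
  "memory_information t N K =
     prob_space.mutual_information (joint_law t N K) 2 (count_space (vertices t)) N fst snd"

definition decoder :: "nat \<Rightarrow> 'z measure \<Rightarrow> ('z \<Rightarrow> nat \<Rightarrow> real) \<Rightarrow> bool" where
  "decoder t N D \<longleftrightarrow> (\<forall>i<t+2. (\<lambda>z. D z i) \<in> borel_measurable N)"

text \<open>\<open>\<delta> i z\<close> means: given memory \<open>z\<close>, decide that coordinate \<open>i\<close> lies above its threshold.\<close>

definition decision_rule :: "nat \<Rightarrow> 'z measure \<Rightarrow> (nat \<Rightarrow> 'z \<Rightarrow> bool) \<Rightarrow> bool" where
  "decision_rule t N \<delta> \<longleftrightarrow> (\<forall>i<t+2. \<delta> i \<in> N \<rightarrow>\<^sub>M count_space UNIV)"

definition average_decision_error ::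
    "nat \<Rightarrow> 'z measure \<Rightarrow> ((nat \<Rightarrow> real) \<Rightarrow> 'z measure) \<Rightarrow> (nat \<Rightarrow> 'z \<Rightarrow> bool) \<Rightarrow> real" where
  "average_decision_error t N K \<delta> =
     (\<Sum>i<t+2. measure (joint_law t N K)
        {p \<in> space (joint_law t N K). \<delta> i (snd p) \<noteq> (center i < fst p i)}) / real (t+2)"

text \<open>Expected losses are extended nonnegative, so that a non-integrable loss counts as infinite.\<close>

definition uniform_risk ::
    "nat \<Rightarrow> 'z measure \<Rightarrow> ((nat \<Rightarrow> real) \<Rightarrow> 'z measure) \<Rightarrow> ('z \<Rightarrow> (nat \<Rightarrow> real) \<Rightarrow> ennreal) \<Rightarrow> ennreal"
  where "uniform_risk t N K L = (\<integral>\<^sup>+ p. L (snd p) (fst p) \<partial>joint_law t N K)"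

definition conditional_risk ::
    "((nat \<Rightarrow> real) \<Rightarrow> 'z measure) \<Rightarrow> ('z \<Rightarrow> (nat \<Rightarrow> real) \<Rightarrow> ennreal) \<Rightarrow> (nat \<Rightarrow> real) \<Rightarrow> ennreal"
  where "conditional_risk K L x = (\<integral>\<^sup>+ z. L z x \<partial>K x)"

definition worst_risk ::
    "nat \<Rightarrow> ((nat \<Rightarrow> real) \<Rightarrow> 'z measure) \<Rightarrow> ('z \<Rightarrow> (nat \<Rightarrow> real) \<Rightarrow> ennreal) \<Rightarrow> ennreal" where
  "worst_risk t K L = (SUP x\<in>cube t. conditional_risk K L x)"

definition recovery_loss ::
    "nat \<Rightarrow> ('z \<Rightarrow> nat \<Rightarrow> real) \<Rightarrow> 'z \<Rightarrow> (nat \<Rightarrow> real) \<Rightarrow> ennreal" where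
  "recovery_loss t D z x = ennreal (l1_dist (t+2) (D z) x / real (t+2))"

text \<open>
  Fraction of wrong threshold decisions. At points of the cube with \<open>x i = center i\<close> (never a
  vertex) neither decision counts as wrong, which only makes lower bounds on the worst risk stronger.
\<close>

definition decision_loss ::
    "nat \<Rightarrow> (nat \<Rightarrow> 'z \<Rightarrow> bool) \<Rightarrow> 'z \<Rightarrow> (nat \<Rightarrow> real) \<Rightarrow> ennreal" where
  "decision_loss t \<delta> z x =
     ennreal (real (card {i\<in>{..<t+2}. \<delta> i z \<and> x i < center i \<or> \<not> \<delta> i z \<and> center i < x i})
              / real (t+2))"

text \<open>
  A \<open>d\<close>-coordinate implementation storing at most \<open>b\<close> bits per coordinate: the memory is a
  \<open>d\<close>-tuple from a countable alphabet \<open>C\<close> with \<open>H(Z) \<le> b d\<close>. The integrability clause inside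
  \<open>finite_entropy\<close> says \<open>H(Z) < \<infinity>\<close>; without it the library \<open>entropy\<close> would be 0 for infinite
  entropy.
\<close>

definition coordinate_implementation ::
    "nat \<Rightarrow> nat \<Rightarrow> real \<Rightarrow> 'c list set \<Rightarrow> ((nat \<Rightarrow> real) \<Rightarrow> 'c list measure) \<Rightarrow> bool" where
  "coordinate_implementation t d b C K \<longleftrightarrow>
     countable C \<and> (\<forall>w\<in>C. length w = d) \<and> encoder t (count_space C) K \<and>
     (\<exists>f. information_space.finite_entropy (joint_law t (count_space C) K) 2 (count_space C) snd f) \<and>
     prob_space.entropy (joint_law t (count_space C) K) 2 (count_space C) snd \<le> b * real d"


subsection \<open>Continuity criterion and linear memory\<close>

text \<open>Extended real, since the decoder is arbitrary and the error may be unbounded.\<close>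

definition uniform_error ::
    "nat \<Rightarrow> ((nat \<Rightarrow> real) \<Rightarrow> nat \<Rightarrow> real) \<Rightarrow> ((nat \<Rightarrow> real) \<Rightarrow> nat \<Rightarrow> real) \<Rightarrow> ereal" where
  "uniform_error t E D = (SUP x\<in>cube t. ereal (linf_dist (t+2) (D (E x)) x))"

definition continuous_encoder :: "nat \<Rightarrow> nat \<Rightarrow> ((nat \<Rightarrow> real) \<Rightarrow> nat \<Rightarrow> real) \<Rightarrow> bool" where
  "continuous_encoder t d E \<longleftrightarrow>
     continuous_map (subtopology (Euclidean_space (t+2)) (cube t)) (Euclidean_space d) E"

text \<open>
  \<open>feasible t d\<close>: some memory of size \<open>d\<close> meets the criterion at date \<open>t\<close>. The slope \<open>\<kappa>\<close> does not
  depend on \<open>t\<close>.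
\<close>

definition requires_linear_memory :: "real \<Rightarrow> (nat \<Rightarrow> nat \<Rightarrow> bool) \<Rightarrow> bool" where
  "requires_linear_memory \<kappa> feasible \<longleftrightarrow>
     0 < \<kappa> \<and> (\<forall>t\<ge>1. \<forall>d. feasible t d \<longrightarrow> \<kappa> * real (t+2) \<le> real d)"

end

theory Submission
  imports Defs "HOL-Real_Asymp.Real_Asymp"
begin

text \<open>
  Three independent ideas carry the result.

  \<^emph>\<open>Information.\<close> Write \<open>n = t + 2\<close>. The divergence \<open>I(X;Z)\<close> of the joint law from the product of
  its marginals dominates the expected logarithm of every test density \<open>g\<close> for that product
  (\<open>KL_divergence_ge\<close>). For a decision rule with average error \<open>q\<close> take
  \<open>g(x, z) = 2\<^sup>n \<Prod>\<^sub>i (if the decision on coordinate i is wrong then p else 1 - p)\<close>: this is the density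
  of the guess that the decisions err independently with probability \<open>p\<close>. Its expected
  logarithm depends on the rule only through \<open>q\<close>, and \<open>p = q\<close> gives \<open>n (1 - h2 q) \<le> I(X;Z)\<close> in one
  step (\<open>memory.information_ge\<close>). This replaces the usual chain made of Fano's inequality for each
  coordinate, superadditivity of information over independent coordinates and concavity of
  \<open>h2\<close>. Strict monotonicity of \<open>h2\<close> on \<open>[0, 1/2]\<close> inverts the inequality.
  A memory with countable alphabet satisfies \<open>I(X;Z) \<le> H(Z)\<close>
  (\<open>memory_information_le_entropy\<close>), hence the bound on the number of coordinates.

  \<^emph>\<open>Risks.\<close> The uniform risk is an average of conditional risks over vertices, so the worst
  conditional risk is at least as large. Thresholding a decoder at the center errs on a
  coordinate of a vertex only if the decoder is off by \<open>1/8\<close> there, which carries the bound on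
  decisions over to recovery.

  \<^emph>\<open>Continuity.\<close> A continuous map from a box into a space of smaller dimension identifies two points
  on opposite faces (\<open>wide_fibre\<close>); no decoder can be closer than \<open>1/8\<close> to both. Otherwise the
  images of opposite faces would be disjoint compact sets, and the differences of the
  distances to them would form a Lipschitz map of the image of the box into \<open>n\<close>-space which, by a
  Poincare--Miranda argument resting on Kuhn's lemma, comes arbitrarily close to every point of a
  small cube. A pigeonhole count on grids excludes this for a Lipschitz map defined on a bounded
  set of smaller dimension.
\<close>

section \<open>Attainability of the cube\<close>

text \<open>
  Let vintage \<open>s\<close> be certain of outcome \<open>s\<close>, so that robust values are arbitrary reward entries.
  One action realizes \<open>V\<^sub>0, \<dots>, V\<^sub>t\<close>; a second one pays \<open>P\<close> under outcome 0 and is ruined under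
  outcome \<open>t\<close>. Vintage \<open>t\<close> then prefers the first action and vintage 0 the second, since
  \<open>P \<ge> 1/2 > V\<^sub>0\<close>. The two outcomes differ because \<open>t \<ge> 1\<close>.
\<close>
lemma cube_attainable:
  assumes t: "t \<ge> 1"
  shows "\<exists>A \<Omega> \<P> R. one_decision_model t A \<Omega> \<P> \<and> cube t \<subseteq> attainable_vectors t A \<Omega> \<P> R"
proof -
  define A :: "nat set" where "A = {0, 1}"
  define \<P> :: "nat \<Rightarrow> nat pmf set" where "\<P> s = {return_pmf s}" for s
  have "one_decision_model t A {..t} \<P>"
    by (auto simp: one_decision_model_def A_def \<P>_def)
  moreover have "x \<in> attainable_vectors t A {..t} \<P> 1" if x: "x \<in> cube t" for x
  proof -
    define r :: "nat \<Rightarrow> nat \<Rightarrow> real" where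
      "r a \<omega> = (if a = 0 then x (\<omega> + 1) else if \<omega> = 0 then x 0 else - 1)" for a \<omega>
    have rv: "robust_value \<P> r s a = r a s" for s a
      by (simp add: robust_value_def \<P>_def)
    have x0: "\<bar>x 0 - 5/8\<bar> \<le> 1/8" using x by (auto simp: cube_def center_def dest!: spec[of _ 0])
    have xs: "\<bar>x (s + 1)\<bar> \<le> 1/8" if "s \<le> t" for s
      using x that by (auto simp: cube_def center_def dest!: spec[of _ "Suc s"])
    have "\<bar>r a \<omega>\<bar> \<le> 1" if "\<omega> \<le> t" for a \<omega>
      using abs_le_D1[OF x0] abs_le_D2[OF x0] xs[OF that] by (auto simp: r_def abs_le_iff)
    then have "admissible_reward A {..t} 1 r" by (simp add: admissible_reward_def)
    moreover have "subgame_perfect t A \<P> r 0"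
      using t xs[of t] by (auto simp: subgame_perfect_def rv r_def A_def)
    moreover have "precommitment_value A \<P> r = x 0"
      using abs_le_D1[OF x0] abs_le_D2[OF x0] xs[of 0] by (simp add: abs_le_iff precommitment_value_def A_def rv r_def)
    then have "x = value_vector t A \<P> r 0"
      using x by (auto simp: value_vector_def rv r_def cube_def fun_eq_iff)
    ultimately show ?thesis by (auto simp: attainable_vectors_def)
  qed
  ultimately show ?thesis by blast
qed

section \<open>Binary entropy\<close>

text \<open>
  Only the endpoint 0 needs an argument, namely \<open>q log q \<longlongrightarrow> 0\<close>.
\<close>
lemma continuous_on_h2: "continuous_on {0..1/2} h2"
proof -
  have "continuous (at q within {0..1/2}) h2" if q: "q \<in> {0..1/2}" for q
  proof (cases "q = 0")
    case True
    have "((\<lambda>q::real. - q * log 2 q - (1 - q) * log 2 (1 - q)) \<longlongrightarrow> 0) (at_right 0)" by real_asymp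
    then have "(h2 \<longlongrightarrow> h2 0) (at_right 0)" by (simp add: h2_def[abs_def])
    then show ?thesis using True by (simp add: continuous_within at_within_Icc_at_right)
  next
    case False
    with q have "0 < q" "q < 1" by auto
    then have "isCont h2 q" unfolding h2_def[abs_def] by (intro continuous_intros) auto
    then show ?thesis by (rule continuous_at_imp_continuous_at_within)
  qed
  then show ?thesis by (simp add: continuous_on_eq_continuous_within)
qed

text \<open>
  The derivative \<open>log\<^sub>2 ((1 - q) / q)\<close> is positive for \<open>0 < q < 1/2\<close>.
\<close>
lemma h2_strict_mono:
  assumes "0 \<le> p" "p < q" "q \<le> 1/2"
  shows "h2 p < h2 q"
proof (rule DERIV_pos_imp_increasing_open[OF assms(2)])
  fix x assume x: "p < x" "x < q"
  have "(h2 has_real_derivative (log 2 (1 - x) - log 2 x)) (at x)"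
    unfolding h2_def[abs_def]
    by (rule derivative_eq_intros refl | use x assms in \<open>simp add: log_def field_simps\<close>)+
  moreover have "log 2 (1 - x) - log 2 x > 0" using x assms by simp
  ultimately show "\<exists>y. DERIV h2 x :> y \<and> y > 0" by blast
next
  show "continuous_on {p..q} h2" using assms by (intro continuous_on_subset[OF continuous_on_h2]) auto
qed

lemma h2_0: "h2 0 = 0" and h2_half: "h2 (1/2) = 1"
  by (auto simp: h2_def log_divide)

lemma h2_mono: "0 \<le> p \<Longrightarrow> p \<le> q \<Longrightarrow> q \<le> 1/2 \<Longrightarrow> h2 p \<le> h2 q"
  using h2_strict_mono[of p q] by (cases "p = q") auto

lemma h2_less_1: "0 \<le> q \<Longrightarrow> q < 1/2 \<Longrightarrow> h2 q < 1"
  using h2_strict_mono[of q "1/2"] by (simp add: h2_half)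

lemma h2_inv:
  assumes "0 \<le> y" "y \<le> 1"
  shows "h2_inv y \<in> {0..1/2}" "h2 (h2_inv y) = y"
proof -
  have inj: "inj_on h2 {0..1/2}"
    by (rule linorder_inj_onI) (use h2_strict_mono in \<open>fastforce+\<close>)
  have "y \<in> h2 ` {0..1/2}"
    using IVT'[of h2 0 y "1/2"] assms continuous_on_h2 by (auto simp: h2_0 h2_half)
  then show "h2_inv y \<in> {0..1/2}" "h2 (h2_inv y) = y"
    unfolding h2_inv_def using the_inv_into_into[OF inj] f_the_inv_into_f[OF inj] by blast+
qed

text \<open>
  The comparison with \<open>h2 p\<close> is only asked for when \<open>p \<le> 1/2\<close>: beyond the maximum of \<open>h2\<close> it
  would be wrong, but there \<open>h2_inv y \<le> 1/2 < p\<close>.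
\<close>
lemma h2_inv_le:
  assumes y: "0 \<le> y" "y \<le> 1" and p: "0 \<le> p" and le: "p \<le> 1/2 \<Longrightarrow> y \<le> h2 p"
  shows "h2_inv y \<le> p"
proof (rule ccontr)
  assume "\<not> h2_inv y \<le> p"
  then have lt: "p < h2_inv y" by simp
  moreover have "h2_inv y \<le> 1/2" using h2_inv(1)[OF y] by simp
  ultimately have "h2 p < h2 (h2_inv y)" using p by (intro h2_strict_mono)
  then show False using le lt \<open>h2_inv y \<le> 1/2\<close> h2_inv(2)[OF y] by simp
qed

section \<open>Continuous maps that lower the dimension\<close>

text \<open>
  Points vanish beyond index \<open>n\<close>, so that the dimension is a number and not a type: the statement
  to be proved quantifies over it.
\<close>
definition box_at :: "nat \<Rightarrow> (nat \<Rightarrow> real) \<Rightarrow> real \<Rightarrow> (nat \<Rightarrow> real) set" where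
  "box_at n c r = {x. (\<forall>i<n. \<bar>x i - c i\<bar> \<le> r) \<and> (\<forall>i\<ge>n. x i = 0)}"

lemma compact_box_at: "compact (box_at n c r)"
proof -
  have "box_at n c r = PiE UNIV (\<lambda>i. if i < n then {c i - r..c i + r} else {0})"
  proof (rule set_eqI)
    fix x :: "nat \<Rightarrow> real"
    have "\<bar>x i - c i\<bar> \<le> r \<longleftrightarrow> x i \<in> {c i - r..c i + r}" for i by auto
    moreover have "x \<in> PiE UNIV F \<longleftrightarrow> (\<forall>i. x i \<in> F i)" for F by (auto simp: PiE_iff)
    ultimately show "x \<in> box_at n c r \<longleftrightarrow> x \<in> PiE UNIV (\<lambda>i. if i < n then {c i - r..c i + r} else {0})"
      unfolding box_at_def by (smt (verit, best) mem_Collect_eq not_less singleton_iff)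
  qed
  moreover have "compactin (powertop_real UNIV) (PiE UNIV (\<lambda>i. if i < n then {c i - r..c i + r} else {0}))"
    by (subst compactin_PiE) auto
  ultimately show ?thesis
    by (metis euclidean_product_topology compactin_euclidean_iff)
qed

text \<open>
  The metric on functions is a weighted sum of truncated distances over all coordinates; here
  continuity is made uniform in terms of the coordinatewise distance, which is what grids control.
\<close>
lemma uniform_continuity_box_at:
  assumes f: "continuous_on (box_at n c r) (f :: _ \<Rightarrow> real)" and e: "e > 0"
  obtains d where "d > 0"
    "\<And>x y. x \<in> box_at n c r \<Longrightarrow> y \<in> box_at n c r \<Longrightarrow> (\<And>i. \<bar>x i - y i\<bar> \<le> d) \<Longrightarrow> \<bar>f x - f y\<bar> < e"
proof -
  have "uniformly_continuous_on (box_at n c r) f"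
    using f compact_box_at by (rule compact_uniformly_continuous)
  then obtain \<delta> where \<delta>: "\<delta> > 0"
    "\<And>x y. x \<in> box_at n c r \<Longrightarrow> y \<in> box_at n c r \<Longrightarrow> dist y x < \<delta> \<Longrightarrow> dist (f y) (f x) < e"
    using e unfolding uniformly_continuous_on_def by metis
  obtain N where N: "(1/2::real)^N < \<delta>/2"
    using real_arch_pow_inv[of "\<delta>/2" "1/2"] \<delta>(1) by auto
  show thesis
  proof
    show "\<delta>/4 > 0" using \<delta>(1) by simp
    fix x y assume xy: "x \<in> box_at n c r" "y \<in> box_at n c r" and d: "\<And>i. \<bar>x i - y i\<bar> \<le> \<delta>/4"
    have "dist y x \<le> 2 * Max {dist (y (from_nat n)) (x (from_nat n)) |n. n \<le> N} + (1/2)^N"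
      by (rule dist_fun_le_dist_first_terms)
    moreover have "Max {dist (y (from_nat n)) (x (from_nat n)) |n. n \<le> N} \<le> \<delta>/4"
      using d by (subst Max_le_iff) (auto simp: dist_real_def abs_minus_commute)
    ultimately have "dist y x < \<delta>" using N by linarith
    then show "\<bar>f x - f y\<bar> < e"
      using \<delta>(2)[OF xy] by (simp add: dist_real_def abs_minus_commute)
  qed
qed

text \<open>
  A grid point is labelled in coordinate \<open>k\<close> by whether \<open>G k\<close> exceeds \<open>v k\<close>. The conditions on the
  faces are the boundary conditions of Kuhn's lemma, which yields a cell on which every label
  takes both values; by uniform continuity every \<open>G k\<close> is then close to \<open>v k\<close> on the
  whole cell. An approximate solution is enough below, so no limit of finer grids is taken.
\<close>
lemma poincare_miranda_approx:
  assumes r: "r > 0"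
    and G: "\<And>k. k < n \<Longrightarrow> continuous_on (box_at n c r) (G k)"
    and lo: "\<And>k x. k < n \<Longrightarrow> x \<in> box_at n c r \<Longrightarrow> x k = c k - r \<Longrightarrow> G k x \<le> v k"
    and hi: "\<And>k x. k < n \<Longrightarrow> x \<in> box_at n c r \<Longrightarrow> x k = c k + r \<Longrightarrow> v k < (G k x :: real)"
    and e: "e > 0"
  shows "\<exists>x\<in>box_at n c r. \<forall>k<n. \<bar>G k x - v k\<bar> < e"
proof -
  have "\<forall>k\<in>{..<n}. \<exists>d>0. \<forall>x\<in>box_at n c r. \<forall>y\<in>box_at n c r. (\<forall>i. \<bar>x i - y i\<bar> \<le> d) \<longrightarrow> \<bar>G k x - G k y\<bar> < e"
    using uniform_continuity_box_at[OF G e] by (metis lessThan_iff)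
  then obtain dd where dd: "\<And>k. k < n \<Longrightarrow> dd k > 0"
    "\<And>k x y. k < n \<Longrightarrow> x \<in> box_at n c r \<Longrightarrow> y \<in> box_at n c r \<Longrightarrow> (\<forall>i. \<bar>x i - y i\<bar> \<le> dd k) \<Longrightarrow> \<bar>G k x - G k y\<bar> < e"
    by (metis lessThan_iff)
  \<comment> \<open>The 1 keeps the minimum defined when there are no coordinates.\<close>
  define d where "d = Min (insert 1 (dd ` {..<n}))"
  have d: "d > 0" using dd(1) by (auto simp: d_def)
  have d_le: "d \<le> dd k" if "k < n" for k using that by (auto simp: d_def)
  obtain p :: nat where p: "2*r/d < real p" using reals_Archimedean2 by blast
  have p0: "0 < p" using p r d
    by (metis divide_pos_pos less_trans mult_pos_pos of_nat_0_less_iff zero_less_numeral)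
  have step: "2*r/real p \<le> d"
    using p p0 d by (simp add: field_simps)
  define \<phi> where "\<phi> q i = (if i < n then c i - r + 2*r/real p * real (q i) else 0)" for q :: "nat \<Rightarrow> nat" and i
  have \<phi>: "\<phi> q \<in> box_at n c r" if "\<forall>i<n. q i \<le> p" for q
  proof -
    have "0 \<le> 2*r/real p * real (q i)" "2*r/real p * real (q i) \<le> 2*r" if "i < n" for i
      using r p0 \<open>\<forall>i<n. q i \<le> p\<close> that by (auto simp: field_simps)
    then show ?thesis by (force simp: box_at_def \<phi>_def abs_le_iff)
  qed
  define label :: "(nat \<Rightarrow> nat) \<Rightarrow> nat \<Rightarrow> nat" where
    "label q k = (if G k (\<phi> q) \<le> v k then 0 else 1)" for q k
  obtain q where q: "\<forall>i<n. q i < p" and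
    rs: "\<forall>i<n. \<exists>r s. (\<forall>j<n. q j \<le> r j \<and> r j \<le> q j + 1) \<and> (\<forall>j<n. q j \<le> s j \<and> s j \<le> q j + 1) \<and> label r i \<noteq> label s i"
  proof (rule kuhn_lemma[OF p0, of n label])
    show "\<forall>x. (\<forall>i<n. x i \<le> p) \<longrightarrow> (\<forall>i<n. label x i = 0 \<or> label x i = 1)" by (auto simp: label_def)
    show "\<forall>x. (\<forall>i<n. x i \<le> p) \<longrightarrow> (\<forall>i<n. x i = 0 \<longrightarrow> label x i = 0)"
      using lo \<phi> by (auto simp: label_def \<phi>_def)
    show "\<forall>x. (\<forall>i<n. x i \<le> p) \<longrightarrow> (\<forall>i<n. x i = p \<longrightarrow> label x i = 1)"
    proof (intro allI impI)
      fix x i assume x: "\<forall>i<n. x i \<le> p" "i < n" "x i = p"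
      have "\<phi> x i = c i + r" using x p0 by (simp add: \<phi>_def)
      then show "label x i = 1" using hi[OF x(2) \<phi>[OF x(1)]] by (auto simp: label_def)
    qed
  qed
  have near: "\<bar>G k (\<phi> q) - G k (\<phi> s)\<bar> < e" if k: "k < n" and s: "\<forall>j<n. q j \<le> s j \<and> s j \<le> q j + 1" for k s
  proof (rule dd(2)[OF k])
    show "\<phi> q \<in> box_at n c r" using q by (intro \<phi>) auto
    show "\<phi> s \<in> box_at n c r" using q s by (intro \<phi>) (metis Suc_eq_plus1 Suc_leI le_trans)
    show "\<forall>i. \<bar>\<phi> q i - \<phi> s i\<bar> \<le> dd k"
    proof
      fix i
      show "\<bar>\<phi> q i - \<phi> s i\<bar> \<le> dd k"
      proof (cases "i < n")
        case True
        have "\<phi> q i - \<phi> s i = 2*r/real p * (real (q i) - real (s i))"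
          using True by (simp add: \<phi>_def right_diff_distrib)
        then have "\<bar>\<phi> q i - \<phi> s i\<bar> = 2*r/real p * \<bar>real (q i) - real (s i)\<bar>"
          using r by (simp add: abs_mult)
        also have "\<dots> \<le> 2*r/real p * 1"
          using r s True by (intro mult_left_mono) (auto simp: abs_le_iff dest!: spec[of _ i])
        also have "\<dots> \<le> dd k" using step d_le[OF k] by simp
        finally show ?thesis .
      qed (use dd(1)[OF k] in \<open>simp add: \<phi>_def\<close>)
    qed
  qed
  have "\<bar>G k (\<phi> q) - v k\<bar> < e" if k: "k < n" for k
  proof -
    obtain s s' where s: "\<forall>j<n. q j \<le> s j \<and> s j \<le> q j + 1" "\<forall>j<n. q j \<le> s' j \<and> s' j \<le> q j + 1"
      "label s k \<noteq> label s' k" using rs k by blast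
    show ?thesis using near[OF k s(1)] near[OF k s(2)] s(3)
      by (auto simp: label_def abs_less_iff split: if_splits)
  qed
  then show ?thesis using \<phi>[of q] q by (meson less_imp_le)
qed

text \<open>
  Consider the \<open>N\<^sup>n\<close> grid points of spacing \<open>\<delta>/N\<close> in the cube of side \<open>\<delta>\<close>. If each were
  approximated within a quarter of the spacing by a value at a point of \<open>S\<close>, these points of \<open>S\<close>
  would lie in distinct cells of a grid of mesh proportional to \<open>1/N\<close> in dimension \<open>d\<close>, of which
  there are at most \<open>(C N)\<^sup>d\<close>. Since \<open>d < n\<close>, this fails as soon as \<open>N > C\<^sup>d\<close>.
\<close>
lemma lipschitz_image_not_dense:
  fixes h :: "nat \<Rightarrow> (nat \<Rightarrow> real) \<Rightarrow> real"
  assumes dn: "d < n" and \<delta>: "\<delta> > 0" and L: "L \<ge> 0" and M: "M \<ge> 0"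
    and lip: "\<And>k y y'. k < n \<Longrightarrow> \<bar>h k y - h k y'\<bar> \<le> L * (\<Sum>i<d. \<bar>y i - y' i\<bar>)"
    and S: "\<And>y i. y \<in> S \<Longrightarrow> i < d \<Longrightarrow> \<bar>y i\<bar> \<le> M"
  obtains v e where "\<And>k. k < n \<Longrightarrow> 0 \<le> v k \<and> v k < \<delta>" "e > 0"
    "\<And>y. y \<in> S \<Longrightarrow> \<exists>k<n. \<bar>h k y - v k\<bar> \<ge> e"
proof -
  \<comment> \<open>Mesh \<open>1/s\<close> makes values on one cell differ by at most \<open>L d / s \<le> \<delta>/(4N)\<close>, a quarter of the spacing.\<close>
  define s0 where "s0 = 4 * (L * real d + 1) / \<delta>"
  obtain C :: nat where C: "2 * M * s0 + 3 \<le> real C" using real_arch_simple by blast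
  define N where "N = C ^ d + 1"
  have N0: "N > 0" by (simp add: N_def)
  have s0: "s0 > 0" using L \<delta> by (simp add: s0_def add_nonneg_pos)
  define s where "s = s0 * real N"
  have s: "s > 0" using s0 N0 by (simp add: s_def)
  define e where "e = \<delta> / (4 * real N)"
  have e: "e > 0" using \<delta> N0 by (simp add: e_def)
  define v where "v a k = \<delta> * real (a k) / real N" for a :: "nat \<Rightarrow> nat" and k
  define A where "A = PiE {..<n} (\<lambda>_. {..<N})"
  have vA: "0 \<le> v a k \<and> v a k < \<delta>" if "a \<in> A" "k < n" for a k
    using that \<delta> N0 by (auto simp: v_def A_def PiE_iff field_simps)
  show thesis
  proof (cases "\<exists>a\<in>A. \<forall>y\<in>S. \<exists>k<n. \<bar>h k y - v a k\<bar> \<ge> e")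
    case True
    then show thesis using that vA e by metis
  next
    case False
    then have "\<forall>a\<in>A. \<exists>y\<in>S. \<forall>k<n. \<bar>h k y - v a k\<bar> < e" by (meson not_le)
    then obtain y where y: "\<And>a. a \<in> A \<Longrightarrow> y a \<in> S" "\<And>a k. a \<in> A \<Longrightarrow> k < n \<Longrightarrow> \<bar>h k (y a) - v a k\<bar> < e"
      by metis
    define cell where "cell a = restrict (\<lambda>i. \<lfloor>y a i * s\<rfloor>) {..<d}" for a
    define I where "I = {-\<lceil>M * s\<rceil>..\<lceil>M * s\<rceil>}"
    have cellI: "cell a \<in> PiE {..<d} (\<lambda>_. I)" if a: "a \<in> A" for a
    proof -
      have "\<lfloor>y a i * s\<rfloor> \<in> I" if i: "i < d" for i
      proof -
        have "\<bar>y a i * s\<bar> \<le> M * s" using S[OF y(1)[OF a] i] s by (simp add: abs_mult)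
        then have "- (M * s) \<le> y a i * s" "y a i * s \<le> M * s" by (auto simp: abs_le_iff)
        then show ?thesis unfolding I_def by (simp; linarith)
      qed
      then show ?thesis by (auto simp: cell_def)
    qed
    have "inj_on cell A"
    proof (rule inj_onI)
      fix a b assume ab: "a \<in> A" "b \<in> A" "cell a = cell b"
      have near: "\<bar>y a i - y b i\<bar> \<le> 1/s" if "i < d" for i
      proof -
        have "\<lfloor>y a i * s\<rfloor> = \<lfloor>y b i * s\<rfloor>" using ab(3) that
          by (metis cell_def lessThan_iff restrict_apply')
        then have "\<bar>y a i * s - y b i * s\<bar> \<le> 1" by linarith
        then have "\<bar>y a i - y b i\<bar> * s \<le> 1" using s by (simp add: left_diff_distrib[symmetric] abs_mult)
        then show ?thesis using s by (simp add: field_simps)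
      qed
      have "a k = b k" if k: "k < n" for k
      proof -
        have "(\<Sum>i<d. \<bar>y a i - y b i\<bar>) \<le> (\<Sum>i<d. 1/s)" using near by (intro sum_mono) auto
        then have "(\<Sum>i<d. \<bar>y a i - y b i\<bar>) \<le> real d / s" by simp
        then have "L * (\<Sum>i<d. \<bar>y a i - y b i\<bar>) \<le> L * (real d / s)" using L by (rule mult_left_mono)
        also have "\<dots> \<le> e"
        proof -
          have "e * s = L * real d + 1" using \<delta> N0 by (simp add: e_def s_def s0_def field_simps)
          then have "L * real d \<le> e * s" by simp
          then show ?thesis using s by (simp add: field_simps)
        qed
        finally have "\<bar>h k (y a) - h k (y b)\<bar> \<le> e" using lip[OF k, of "y a" "y b"] by linarith
        then have "\<bar>v a k - v b k\<bar> < 4 * e"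
          using y(2)[OF ab(1) k] y(2)[OF ab(2) k] e by linarith
        moreover have "v a k - v b k = 4 * e * (real (a k) - real (b k))"
          using N0 by (simp add: v_def e_def field_simps)
        ultimately have "4 * e * \<bar>real (a k) - real (b k)\<bar> < 4 * e * 1" using e by (simp add: abs_mult)
        then have "\<bar>real (a k) - real (b k)\<bar> < 1" using e by (simp only: mult_less_cancel_left_pos)
        then show ?thesis by linarith
      qed
      then show "a = b" using ab(1,2) unfolding A_def by (intro PiE_ext) auto
    qed
    then have "card A \<le> card (PiE {..<d} (\<lambda>_. I))"
      using cellI by (intro card_inj_on_le[of cell]) (auto intro!: finite_PiE simp: I_def)
    then have le: "N ^ n \<le> card I ^ d" by (simp add: A_def card_PiE)
    have "real (card I) \<le> 2 * (M * s) + 3"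
    proof -
      have "0 \<le> \<lceil>M * s\<rceil>" using M s by (simp add: less_le_trans[of "-1" 0])
      then have "real (card I) = 2 * of_int \<lceil>M * s\<rceil> + 1" by (simp add: I_def)
      also have "\<dots> \<le> 2 * (M * s + 1) + 1" using of_int_ceiling_le_add_one[of "M * s"] by argo
      finally show ?thesis by simp
    qed
    also have "\<dots> \<le> (2 * M * s0 + 3) * real N"
      using N0 by (simp add: s_def algebra_simps)
    also have "\<dots> \<le> real (C * N)" using C by (simp add: mult_right_mono)
    finally have "card I \<le> C * N" by linarith
    then have "card I ^ d \<le> (C * N) ^ d" by (rule power_mono) simp
    also have "\<dots> < N ^ (d + 1)" by (simp add: power_mult_distrib) (simp add: N_def)
    also have "\<dots> \<le> N ^ n" using dn N0 by (intro power_increasing) auto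
    finally show thesis using le by simp
  qed
qed

text \<open>
  This is the dimension-theoretic core, in the spirit of Lebesgue's covering theorem. Differences
  of distances to the images of opposite faces serve as separating functions because they are
  Lipschitz: for merely continuous ones, space-filling maps would rule out the dimension
  count.
\<close>
lemma wide_fibre:
  fixes e :: "nat \<Rightarrow> (nat \<Rightarrow> real) \<Rightarrow> real"
  assumes r: "r > 0" and dn: "d < n"
    and cont: "\<And>i. i < d \<Longrightarrow> continuous_on (box_at n c r) (e i)"
  shows "\<exists>k<n. \<exists>x\<in>box_at n c r. \<exists>y\<in>box_at n c r. x k = c k - r \<and> y k = c k + r \<and> (\<forall>i<d. e i x = e i y)"
proof (rule ccontr)
  assume neg: "\<not> ?thesis"
  then have sep: "\<exists>i<d. e i x \<noteq> e i y"
    if "k < n" "x \<in> box_at n c r" "y \<in> box_at n c r" "x k = c k - r" "y k = c k + r" for k x y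
    using that neg by blast
  define Q where "Q = box_at n c r"
  define Lo where "Lo k = {x\<in>Q. x k = c k - r}" for k
  define Hi where "Hi k = {x\<in>Q. x k = c k + r}" for k
  have coord: "continuous_on UNIV (\<lambda>x::nat \<Rightarrow> real. x k)" for k
    by (rule continuous_on_product_coordinates)
  have closed_face: "closed {x::nat\<Rightarrow>real. x k = a}" for k a
    by (intro closed_Collect_eq coord continuous_on_const)
  have compactLo: "compact (Lo k)" and compactHi: "compact (Hi k)" for k
    using compact_Int_closed[OF compact_box_at closed_face]
    by (auto simp: Lo_def Hi_def Q_def Collect_conj_eq Int_commute)
  \<comment> \<open>Centers of faces, as witnesses that faces are nonempty.\<close>
  define pt where "pt s k i = (if i < n then c i + (if i = k then s else 0) else 0)" for s :: real and k i :: nat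
  have "pt (-r) k \<in> Lo k" "pt r k \<in> Hi k" if "k < n" for k
    using r that by (auto simp: pt_def Lo_def Hi_def Q_def box_at_def)
  then have ne: "Lo k \<noteq> {}" "Hi k \<noteq> {}" if "k < n" for k using that by blast+
  define \<rho> where "\<rho> y y' = (\<Sum>i<d. \<bar>y i - y' i\<bar>)" for y y' :: "nat \<Rightarrow> real"
  define E where "E x i = e i x" for x i
  have \<rho>_nn: "\<rho> y y' \<ge> 0" for y y' by (simp add: \<rho>_def sum_nonneg)
  have \<rho>_tri: "\<rho> y z \<le> \<rho> y y' + \<rho> y' z" for y y' z
    unfolding \<rho>_def sum.distrib[symmetric] by (intro sum_mono) linarith
  have \<rho>_sym: "\<rho> y z = \<rho> z y" for y z
    unfolding \<rho>_def by (intro sum.cong) (auto simp: abs_minus_commute)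
  have \<rho>_refl: "\<rho> y y = 0" for y by (simp add: \<rho>_def)
  have gap: "\<exists>g>0. \<forall>x\<in>Lo k. \<forall>y\<in>Hi k. g \<le> \<rho> (E x) (E y)" if k: "k < n" for k
  proof -
    have sub: "Lo k \<subseteq> Q" "Hi k \<subseteq> Q" by (auto simp: Lo_def Hi_def)
    have "continuous_on (Lo k \<times> Hi k) (\<lambda>p. \<rho> (E (fst p)) (E (snd p)))"
      unfolding \<rho>_def E_def
    proof (intro continuous_intros)
      fix i assume i: "i \<in> {..<d}"
      show "continuous_on (Lo k \<times> Hi k) (\<lambda>p. e i (fst p))"
        by (rule continuous_on_compose2[OF cont]) (use i sub in \<open>auto simp: Q_def intro!: continuous_on_fst continuous_on_snd continuous_on_id\<close>)
      show "continuous_on (Lo k \<times> Hi k) (\<lambda>p. e i (snd p))"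
        by (rule continuous_on_compose2[OF cont]) (use i sub in \<open>auto simp: Q_def intro!: continuous_on_fst continuous_on_snd continuous_on_id\<close>)
    qed
    then obtain p where p: "p \<in> Lo k \<times> Hi k"
      "\<And>p'. p' \<in> Lo k \<times> Hi k \<Longrightarrow> \<rho> (E (fst p)) (E (snd p)) \<le> \<rho> (E (fst p')) (E (snd p'))"
      using continuous_attains_inf[of "Lo k \<times> Hi k"] compact_Times[OF compactLo compactHi] ne[OF k] by blast
    have "\<exists>i<d. e i (fst p) \<noteq> e i (snd p)"
      using p(1) by (intro sep[OF k]) (auto simp: Lo_def Hi_def Q_def)
    then have "\<rho> (E (fst p)) (E (snd p)) > 0"
      unfolding \<rho>_def E_def by (auto intro!: sum_pos2)
    then show ?thesis using p(2) by fastforce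
  qed
  then obtain g where g: "\<And>k. k < n \<Longrightarrow> g k > 0"
    "\<And>k x y. k < n \<Longrightarrow> x \<in> Lo k \<Longrightarrow> y \<in> Hi k \<Longrightarrow> g k \<le> \<rho> (E x) (E y)" by metis
  define \<delta> where "\<delta> = Min (insert 1 (g ` {..<n}))"
  have \<delta>: "\<delta> > 0" using g(1) by (auto simp: \<delta>_def)
  have \<delta>_le: "\<delta> \<le> g k" if "k < n" for k using that by (auto simp: \<delta>_def)
  define dst where "dst F y = (INF x\<in>F. \<rho> y (E x))" for F y
  have dst_le: "dst F y \<le> \<rho> y (E x)" if "x \<in> F" for F x y
    unfolding dst_def using that \<rho>_nn by (intro cINF_lower bdd_belowI2[of _ 0]) auto
  have dst_ge: "m \<le> dst F y" if "F \<noteq> {}" "\<And>x. x \<in> F \<Longrightarrow> m \<le> \<rho> y (E x)" for F y m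
    unfolding dst_def using that by (intro cINF_greatest) auto
  have dst_lip1: "dst F y \<le> dst F y' + \<rho> y y'" if "F \<noteq> {}" for F y y'
  proof -
    have "dst F y - \<rho> y y' \<le> \<rho> y' (E x)" if "x \<in> F" for x
      using dst_le[OF that, of y] \<rho>_tri[of y "E x" y'] by linarith
    then have "dst F y - \<rho> y y' \<le> dst F y'" using that by (intro dst_ge)
    then show ?thesis by simp
  qed
  \<comment> \<open>At least \<open>\<delta>\<close> on the image of the upper face, at most \<open>-\<delta>\<close> on that of the lower one.\<close>
  define h where "h k y = dst (Lo k) y - dst (Hi k) y" for k y
  have lip: "\<bar>h k y - h k y'\<bar> \<le> 2 * (\<Sum>i<d. \<bar>y i - y' i\<bar>)" if k: "k < n" for k y y'
    using dst_lip1[OF ne(1)[OF k], of y y'] dst_lip1[OF ne(1)[OF k], of y' y]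
      dst_lip1[OF ne(2)[OF k], of y y'] dst_lip1[OF ne(2)[OF k], of y' y] \<rho>_sym[of y y']
    unfolding h_def \<rho>_def[symmetric] by (simp add: abs_le_iff)
  have "\<forall>i<d. \<exists>m. \<forall>x\<in>Q. \<bar>e i x\<bar> \<le> m"
    using compact_imp_bounded[OF compact_continuous_image[OF cont compact_box_at]]
    by (fastforce simp: bounded_iff Q_def)
  then obtain m where m: "\<And>i x. i < d \<Longrightarrow> x \<in> Q \<Longrightarrow> \<bar>e i x\<bar> \<le> m i" by metis
  define M where "M = Max (insert 0 (m ` {..<d}))"
  have M0: "M \<ge> 0" by (simp add: M_def)
  have EM: "\<bar>y i\<bar> \<le> M" if "y \<in> E ` Q" "i < d" for y i
  proof -
    have "m i \<le> M" using that by (auto simp: M_def)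
    then show ?thesis using m that by (force simp: E_def)
  qed
  obtain v \<epsilon> where v: "\<And>k. k < n \<Longrightarrow> 0 \<le> v k \<and> v k < \<delta>" and \<epsilon>: "\<epsilon> > 0"
    and avoid: "\<And>y. y \<in> E ` Q \<Longrightarrow> \<exists>k<n. \<bar>h k y - v k\<bar> \<ge> \<epsilon>"
  proof (rule lipschitz_image_not_dense[OF dn \<delta>, of 2 M h "E ` Q"])
    show "0 \<le> (2::real)" by simp
    show "0 \<le> M" by (rule M0)
    show "\<bar>h k y - h k y'\<bar> \<le> 2 * (\<Sum>i<d. \<bar>y i - y' i\<bar>)" if "k < n" for k y y'
      using that by (rule lip)
    show "\<bar>y i\<bar> \<le> M" if "y \<in> E ` Q" "i < d" for y i using that by (rule EM)
  qed (rule that)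
  have "\<exists>x\<in>Q. \<forall>k<n. \<bar>h k (E x) - v k\<bar> < \<epsilon>"
    unfolding Q_def
  proof (rule poincare_miranda_approx[OF r _ _ _ \<epsilon>])
    fix k assume k: "k < n"
    show "continuous_on (box_at n c r) (\<lambda>x. h k (E x))"
      unfolding continuous_on_def
    proof
      fix x assume x: "x \<in> box_at n c r"
      have "((\<lambda>x'. 2 * (\<Sum>i<d. \<bar>e i x' - e i x\<bar>)) \<longlongrightarrow> 2 * (\<Sum>i<d. \<bar>e i x - e i x\<bar>)) (at x within box_at n c r)"
        using cont x unfolding continuous_on_def by (intro tendsto_intros) auto
      then have "((\<lambda>x'. 2 * (\<Sum>i<d. \<bar>e i x' - e i x\<bar>)) \<longlongrightarrow> 0) (at x within box_at n c r)" by simp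
      then have "((\<lambda>x'. h k (E x') - h k (E x)) \<longlongrightarrow> 0) (at x within box_at n c r)"
      proof (rule Lim_null_comparison[rotated])
        have "\<bar>h k (E x') - h k (E x)\<bar> \<le> 2 * (\<Sum>i<d. \<bar>e i x' - e i x\<bar>)" for x'
          using lip[OF k, of "E x'" "E x"] by (simp add: E_def)
        then show "\<forall>\<^sub>F x' in at x within box_at n c r. norm (h k (E x') - h k (E x)) \<le> 2 * (\<Sum>i<d. \<bar>e i x' - e i x\<bar>)"
          by simp
      qed
      then show "((\<lambda>x'. h k (E x')) \<longlongrightarrow> h k (E x)) (at x within box_at n c r)"
        by (simp add: LIM_zero_iff)
    qed
  next
    fix k x assume k: "k < n" and x: "x \<in> box_at n c r" "x k = c k - r"
    then have xL: "x \<in> Lo k" by (simp add: Lo_def Q_def)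
    have "g k \<le> dst (Hi k) (E x)" using g(2)[OF k xL] ne[OF k] by (intro dst_ge) auto
    then show "h k (E x) \<le> v k"
      using dst_le[OF xL, of "E x"] v[OF k] g(1)[OF k] by (simp add: h_def \<rho>_refl)
  next
    fix k x assume k: "k < n" and x: "x \<in> box_at n c r" "x k = c k + r"
    then have xH: "x \<in> Hi k" by (simp add: Hi_def Q_def)
    have "g k \<le> dst (Lo k) (E x)" using g(2)[OF k _ xH] ne[OF k] \<rho>_sym by (intro dst_ge) auto
    then show "v k < h k (E x)"
      using dst_le[OF xH, of "E x"] v[OF k] \<delta>_le[OF k] by (simp add: h_def \<rho>_refl)
  qed
  then show False using avoid by (meson imageI not_less)
qed

text \<open>
  The two points of a wide fibre differ by \<open>1/4\<close> in one coordinate but are decoded alike.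
\<close>
lemma uniform_error_ge:
  assumes E: "continuous_encoder t d E" and d: "d < t+2"
  shows "uniform_error t E D \<ge> 1/8"
proof (rule ccontr)
  assume "\<not> ?thesis"
  then have small: "uniform_error t E D < 1/8" by simp
  have cube: "cube t = box_at (t+2) center (1/8)" by (simp add: cube_def box_at_def)
  have close: "\<bar>D (E x) i - x i\<bar> < 1/8" if "x \<in> cube t" "i < t+2" for x i
  proof -
    have "ereal (linf_dist (t+2) (D (E x)) x) \<le> uniform_error t E D"
      unfolding uniform_error_def using that by (intro SUP_upper)
    also have "\<dots> < ereal (1/8)" using small by (simp add: one_ereal_def)
    finally have "linf_dist (t+2) (D (E x)) x < 1/8" by (simp only: less_ereal.simps)
    moreover have "\<bar>D (E x) i - x i\<bar> \<le> linf_dist (t+2) (D (E x)) x"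
      unfolding linf_dist_def using that by (intro Max_ge) auto
    ultimately show ?thesis by linarith
  qed
  have "topspace (subtopology (Euclidean_space (t+2)) (cube t)) = cube t"
    by (auto simp: topspace_Euclidean_space cube_def)
  then have cont: "continuous_on (cube t) E" and ran: "E \<in> cube t \<rightarrow> {x. \<forall>i\<ge>d. x i = 0}"
    using E by (auto simp: continuous_encoder_def cm_Euclidean_space_iff_continuous_on topspace_Euclidean_space)
  have "continuous_on (box_at (t+2) center (1/8)) (\<lambda>x. E x i)" for i
    using cont unfolding cube by (rule continuous_on_product_then_coordinatewise)
  then obtain k x y where kxy: "k < t+2" "x \<in> cube t" "y \<in> cube t" "x k = center k - 1/8" "y k = center k + 1/8"
    "\<forall>i<d. E x i = E y i"
    using wide_fibre[of "1/8" d "t+2" center "\<lambda>i x. E x i"] d unfolding cube by auto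
  have "E x = E y"
  proof
    fix i show "E x i = E y i" using kxy ran by (cases "i < d") (auto simp: Pi_iff)
  qed
  then show False using close[OF kxy(2,1)] close[OF kxy(3,1)] kxy(4,5) by auto
qed

section \<open>Divergence of a bounded density\<close>

text \<open>
  The Radon--Nikodym derivative exceeds \<open>c\<close> only on a null set. A version bounded everywhere makes
  all the integrals below converge trivially.
\<close>
lemma bounded_density_exists:
  assumes Q: "prob_space Q" and J: "prob_space J" "sets J = sets Q" and c: "c > 0"
    and le: "\<And>A. A \<in> sets Q \<Longrightarrow> emeasure J A \<le> ennreal c * emeasure Q A"
  obtains f where "f \<in> borel_measurable Q" "\<And>x. 0 \<le> f x" "\<And>x. f x \<le> c" "J = density Q (\<lambda>x. ennreal (f x))"
proof -
  interpret Q: prob_space Q by fact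
  have "absolutely_continuous Q J"
    using le J by (auto simp: absolutely_continuous_def null_sets_def) (metis le_zero_eq mult_zero_right)
  then obtain F where F[measurable]: "F \<in> borel_measurable Q" and JF: "density Q F = J"
    using Q.Radon_Nikodym J by blast
  define S where "S = {x\<in>space Q. F x > ennreal c}"
  have S[measurable]: "S \<in> sets Q" unfolding S_def by measurable
  have fin: "(\<integral>\<^sup>+x. ennreal c * indicator S x \<partial>Q) < \<infinity>"
    using Q.emeasure_finite[of S]
    by (auto simp: nn_integral_cmult_indicator ennreal_mult_eq_top_iff less_top[symmetric])
  have "(\<integral>\<^sup>+x. F x * indicator S x \<partial>Q) \<le> (\<integral>\<^sup>+x. ennreal c * indicator S x \<partial>Q)"
    using le[OF S] by (simp add: JF[symmetric] emeasure_density nn_integral_cmult_indicator)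
  moreover have "(\<integral>\<^sup>+x. F x * indicator S x - ennreal c * indicator S x \<partial>Q)
      = (\<integral>\<^sup>+x. F x * indicator S x \<partial>Q) - (\<integral>\<^sup>+x. ennreal c * indicator S x \<partial>Q)"
    using fin by (intro nn_integral_diff AE_I2) (auto simp: S_def indicator_def)
  ultimately have "(\<integral>\<^sup>+x. F x * indicator S x - ennreal c * indicator S x \<partial>Q) = 0"
    using fin by (simp add: diff_eq_0_ennreal order.strict_trans1)
  then have "AE x in Q. F x * indicator S x - ennreal c * indicator S x = 0"
    by (subst (asm) nn_integral_0_iff_AE) auto
  then have bd: "AE x in Q. F x \<le> ennreal c"
    using AE_space
  proof eventually_elim
    case (elim x)
    show ?case
    proof (rule ccontr)
      assume n: "\<not> F x \<le> ennreal c"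
      then have "x \<in> S" using elim(2) by (simp add: S_def)
      then have "F x - ennreal c = 0" using elim(1) by simp
      then show False using n by (simp add: diff_eq_0_iff_ennreal)
    qed
  qed
  show thesis
  proof
    show "(\<lambda>x. min c (enn2real (F x))) \<in> borel_measurable Q" by measurable
    show "J = density Q (\<lambda>x. ennreal (min c (enn2real (F x))))"
      unfolding JF[symmetric]
    proof (rule density_cong)
      show "AE x in Q. F x = ennreal (min c (enn2real (F x)))"
        using bd
      proof eventually_elim
        case (elim x)
        then obtain y where "F x = ennreal y" "0 \<le> y" by (cases "F x") (auto simp: top_unique)
        then show ?case using elim c by (simp add: min_def)
      qed
    qed auto
  qed (use c in auto)
qed

text \<open>
  The function \<open>y log y\<close> is bounded on bounded intervals, with lower bound \<open>- 1 / ln 2\<close>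
  from \<open>ln u \<le> u - 1\<close> at \<open>u = 1/y\<close>.
\<close>
lemma (in finite_measure) integrable_bounded_mult_log:
  assumes f[measurable]: "f \<in> borel_measurable M" and f0: "\<And>x. 0 \<le> f x" and fc: "\<And>x. f x \<le> c"
  shows "integrable M (\<lambda>x. f x * log 2 (f x))"
proof -
  show ?thesis
  proof (rule integrable_const_bound[where B="1 / ln 2 + c * \<bar>log 2 c\<bar>"])
    show "AE x in M. norm (f x * log 2 (f x)) \<le> 1 / ln 2 + c * \<bar>log 2 c\<bar>"
    proof (rule AE_I2)
      fix x
      show "norm (f x * log 2 (f x)) \<le> 1 / ln 2 + c * \<bar>log 2 c\<bar>"
      proof (cases "f x = 0")
        case True then show ?thesis using fc[of x] by simp
      next
        case False
        then have fx: "f x > 0" using f0[of x] by simp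
        then have "ln (1 / f x) \<le> 1 / f x - 1" by (intro ln_le_minus_one) simp
        then have "f x * (- ln (f x)) \<le> f x * (1 / f x - 1)" using fx by (intro mult_left_mono) (auto simp: ln_div)
        also have "\<dots> \<le> 1" using fx by (simp add: field_simps)
        finally have "f x * (- ln (f x)) / ln 2 \<le> 1 / ln 2" by (intro divide_right_mono) auto
        then have lo: "- (f x * log 2 (f x)) \<le> 1 / ln 2" by (simp add: log_def)
        have "f x * log 2 (f x) \<le> f x * \<bar>log 2 c\<bar>"
          using fx fc[of x] by (intro mult_left_mono) (auto intro: order_trans[OF log_mono abs_ge_self])
        also have "\<dots> \<le> c * \<bar>log 2 c\<bar>" using fc by (intro mult_right_mono) auto
        finally have hi: "f x * log 2 (f x) \<le> c * \<bar>log 2 c\<bar>" .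
        have "0 \<le> c * \<bar>log 2 c\<bar>" using fx fc[of x] by simp
        moreover have "0 \<le> 1 / ln (2::real)" by simp
        ultimately show ?thesis using lo hi unfolding real_norm_def abs_le_iff by linarith
      qed
    qed
  qed auto
qed

text \<open>
  Gibbs' inequality: integrate \<open>f log g - f log f \<le> (g - f) / ln 2\<close>, which is \<open>ln u \<le> u - 1\<close> at
  \<open>u = g / f\<close>. The right-hand side has nonpositive integral when \<open>g\<close> has mass at most 1.
\<close>
lemma KL_divergence_ge:
  assumes Q: "prob_space Q" and J: "prob_space (density Q (\<lambda>x. ennreal (f x)))"
    and f[measurable]: "f \<in> borel_measurable Q" and f0: "\<And>x. 0 \<le> f x" and fc: "\<And>x. f x \<le> c"
    and g[measurable]: "g \<in> borel_measurable Q" and g0: "0 < a" "\<And>x. a \<le> g x" and gc: "\<And>x. g x \<le> c'"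
    and g1: "(\<integral>x. g x \<partial>Q) \<le> 1"
  shows "(\<integral>x. log 2 (g x) \<partial>density Q (\<lambda>x. ennreal (f x))) \<le> KL_divergence 2 Q (density Q (\<lambda>x. ennreal (f x)))"
proof -
  interpret Q: prob_space Q by fact
  interpret J: prob_space "density Q (\<lambda>x. ennreal (f x))" by fact
  have KL: "KL_divergence 2 Q (density Q (\<lambda>x. ennreal (f x))) = (\<integral>x. f x * log 2 (f x) \<partial>Q)"
    using f0 by (intro Q.KL_density) auto
  have int_f: "integrable Q f"
    by (rule Q.integrable_const_bound[where B=c]) (use f0 fc in auto)
  have "\<bar>g x\<bar> \<le> c'" for x using g0(1) g0(2)[of x] gc[of x] by linarith
  then have int_g: "integrable Q g"
    by (intro Q.integrable_const_bound[where B=c']) auto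
  have f1: "(\<integral>x. f x \<partial>Q) = 1"
  proof -
    have "(\<integral>x. f x * 1 \<partial>Q) = (\<integral>x. 1 \<partial>density Q (\<lambda>x. ennreal (f x)))"
      using f0 by (subst integral_density) auto
    then show ?thesis using J.prob_space by simp
  qed
  have lg: "log 2 a \<le> log 2 (g x)" "log 2 (g x) \<le> log 2 c'" for x
    using g0(1) gc[of x] g0(2)[of x] less_le_trans[OF g0] by (auto intro!: log_mono)
  have int_fg: "integrable Q (\<lambda>x. f x * log 2 (g x))"
  proof (rule Q.integrable_const_bound[where B="c * max \<bar>log 2 a\<bar> \<bar>log 2 c'\<bar>"])
    show "AE x in Q. norm (f x * log 2 (g x)) \<le> c * max \<bar>log 2 a\<bar> \<bar>log 2 c'\<bar>"
    proof (rule AE_I2)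
      fix x
      have "\<bar>log 2 (g x)\<bar> \<le> max \<bar>log 2 a\<bar> \<bar>log 2 c'\<bar>" using lg[of x] by linarith
      then show "norm (f x * log 2 (g x)) \<le> c * max \<bar>log 2 a\<bar> \<bar>log 2 c'\<bar>"
        using f0[of x] fc[of x] by (simp add: abs_mult) (intro mult_mono, auto)
    qed
  qed auto
  have base: "f x * log 2 (g x) - (g x - f x) / ln 2 \<le> f x * log 2 (f x)" for x
  proof (cases "f x = 0")
    case True
    then show ?thesis using g0(1) g0(2)[of x] by simp
  next
    case False
    then have fx: "f x > 0" using f0[of x] by simp
    have gx: "g x > 0" using g0(1) g0(2)[of x] by simp
    have "ln (g x / f x) \<le> g x / f x - 1" using fx gx by (intro ln_le_minus_one) simp
    then have "f x * (ln (g x) - ln (f x)) \<le> f x * (g x / f x - 1)"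
      using fx gx by (intro mult_left_mono) (auto simp: ln_div)
    also have "f x * (g x / f x - 1) = g x - f x" using fx by (simp add: field_simps)
    finally have "f x * ln (g x) - (g x - f x) \<le> f x * ln (f x)" by (simp add: algebra_simps)
    then have "(f x * ln (g x) - (g x - f x)) / ln 2 \<le> f x * ln (f x) / ln 2"
      by (intro divide_right_mono) auto
    then show ?thesis by (simp add: log_def diff_divide_distrib)
  qed
  have int_ff: "integrable Q (\<lambda>x. f x * log 2 (f x))"
    using f f0 fc by (rule Q.integrable_bounded_mult_log)
  have "(\<integral>x. log 2 (g x) \<partial>density Q (\<lambda>x. ennreal (f x))) = (\<integral>x. f x * log 2 (g x) \<partial>Q)"
    using f0 by (subst integral_density) auto
  also have "\<dots> \<le> (\<integral>x. f x * log 2 (g x) \<partial>Q) - ((\<integral>x. g x \<partial>Q) - (\<integral>x. f x \<partial>Q)) / ln 2"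
    using g1 f1 by (simp add: divide_nonpos_pos)
  also have "\<dots> = (\<integral>x. f x * log 2 (g x) - (g x - f x) / ln 2 \<partial>Q)"
    using int_f int_g int_fg by simp
  also have "\<dots> \<le> (\<integral>x. f x * log 2 (f x) \<partial>Q)"
    using int_f int_g int_fg int_ff base by (intro integral_mono) auto
  finally show "(\<integral>x. log 2 (g x) \<partial>density Q (\<lambda>x. ennreal (f x))) \<le> KL_divergence 2 Q (density Q (\<lambda>x. ennreal (f x)))"
    by (simp add: KL)
qed

section \<open>Vertices of the cube\<close>

lemma vertices_subset_cube: "vertices t \<subseteq> cube t"
  by (auto simp: vertices_def cube_def)

text \<open>
  Identifying vertices with sets of coordinates turns sums over vertices into sums over a power
  set, which the binomial expansion \<open>prod_add\<close> evaluates.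
\<close>
definition sign_vertex :: "nat \<Rightarrow> nat set \<Rightarrow> nat \<Rightarrow> real" where
  "sign_vertex t S i = (if i < t+2 then center i + (if i \<in> S then 1/8 else -1/8) else 0)"

lemma sign_vertex_above: "i < t+2 \<Longrightarrow> center i < sign_vertex t S i \<longleftrightarrow> i \<in> S"
  by (simp add: sign_vertex_def)

lemma bij_sign_vertex: "bij_betw (sign_vertex t) (Pow {..<t+2}) (vertices t)"
  unfolding bij_betw_def
proof
  show "inj_on (sign_vertex t) (Pow {..<t+2})"
  proof (rule inj_onI)
    fix S T assume "S \<in> Pow {..<t+2}" "T \<in> Pow {..<t+2}" and eq: "sign_vertex t S = sign_vertex t T"
    moreover have "i \<in> S \<longleftrightarrow> i \<in> T" if "i < t+2" for i
      using sign_vertex_above[OF that, of S] sign_vertex_above[OF that, of T] eq by simp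
    ultimately show "S = T" by blast
  qed
  have "x = sign_vertex t {i\<in>{..<t+2}. center i < x i}" if "x \<in> vertices t" for x
  proof
    fix i
    show "x i = sign_vertex t {i\<in>{..<t+2}. center i < x i} i"
      using that by (cases "i < t+2") (auto simp: vertices_def sign_vertex_def abs_if dest!: spec[of _ i] split: if_splits)
  qed
  moreover have "sign_vertex t S \<in> vertices t" for S by (auto simp: vertices_def sign_vertex_def)
  ultimately show "sign_vertex t ` Pow {..<t+2} = vertices t" by (auto 4 4 simp: image_iff)
qed

lemma finite_vertices[simp]: "finite (vertices t)"
  using bij_betw_finite[OF bij_sign_vertex] by simp

lemma card_vertices: "card (vertices t) = 2 ^ (t+2)"
  using bij_betw_same_card[OF bij_sign_vertex, of t] by (simp add: card_Pow)

lemma vertices_nonempty[simp]: "vertices t \<noteq> {}"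
  using card_vertices[of t] by (metis card.empty power_eq_0_iff zero_neq_numeral)

text \<open>
  For fixed \<open>z\<close>, the errors of the decisions range over all patterns as the vertex varies;
  hence the product weights with parameter \<open>p\<close> sum to 1, whatever was decided.
\<close>
lemma sum_vertices_prod:
  fixes \<delta> :: "nat \<Rightarrow> bool" and p :: real
  shows "(\<Sum>x\<in>vertices t. \<Prod>i<t+2. if \<delta> i \<noteq> (center i < x i) then p else 1 - p) = 1"
proof -
  let ?u = "\<lambda>i. if \<delta> i then 1 - p else p" and ?v = "\<lambda>i. if \<delta> i then p else 1 - p"
  have "(\<Sum>x\<in>vertices t. \<Prod>i<t+2. if \<delta> i \<noteq> (center i < x i) then p else 1 - p)
      = (\<Sum>S\<in>Pow {..<t+2}. \<Prod>i<t+2. if \<delta> i \<noteq> (center i < sign_vertex t S i) then p else 1 - p)"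
    by (rule sum.reindex_bij_betw[OF bij_sign_vertex, symmetric])
  also have "\<dots> = (\<Sum>S\<in>Pow {..<t+2}. (\<Prod>i\<in>S. ?u i) * (\<Prod>i\<in>{..<t+2}-S. ?v i))"
  proof (rule sum.cong[OF refl])
    fix S assume S: "S \<in> Pow {..<t+2}"
    have "(\<Prod>i<t+2. if \<delta> i \<noteq> (center i < sign_vertex t S i) then p else 1 - p)
        = (\<Prod>i<t+2. if i \<in> S then ?u i else ?v i)"
      by (intro prod.cong) (auto simp: sign_vertex_above)
    also have "\<dots> = (\<Prod>i\<in>{..<t+2} \<inter> S. ?u i) * (\<Prod>i\<in>{..<t+2} \<inter> - S. ?v i)"
      by (subst prod.If_cases) auto
    also have "{..<t+2} \<inter> S = S" using S by auto
    also have "{..<t+2} \<inter> - S = {..<t+2} - S" by auto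
    finally show "(\<Prod>i<t+2. if \<delta> i \<noteq> (center i < sign_vertex t S i) then p else 1 - p)
        = (\<Prod>i\<in>S. ?u i) * (\<Prod>i\<in>{..<t+2}-S. ?v i)" .
  qed
  also have "\<dots> = (\<Prod>i<t+2. ?u i + ?v i)" by (rule prod_add[symmetric]) simp
  also have "\<dots> = 1" by (intro prod.neutral) auto
  finally show ?thesis .
qed

section \<open>Information and decision errors\<close>

text \<open>
  A kernel on the cube, seen through its values at the vertices. Below, \<open>J\<close> is the joint law of
  \<open>(X, Z)\<close>, with marginals \<open>PX\<close> and \<open>PZ\<close>, and \<open>w\<close> is the probability of one vertex.
\<close>
locale memory =
  fixes t :: nat and N :: "'z measure" and K :: "(nat \<Rightarrow> real) \<Rightarrow> 'z measure"
  assumes enc: "encoder t N K"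
begin

abbreviation "V \<equiv> vertices t"
abbreviation "XZ \<equiv> count_space V \<Otimes>\<^sub>M N"
abbreviation "J \<equiv> joint_law t N K"
abbreviation "w \<equiv> ennreal (1 / 2 ^ (t+2))"

lemma kernel: "x \<in> cube t \<Longrightarrow> prob_space (K x)" "x \<in> cube t \<Longrightarrow> sets (K x) = sets N"
  using measurable_space[OF enc[unfolded encoder_def], of x]
  by (auto simp: space_prob_algebra space_restrict_space)

lemma prob_K: "x \<in> V \<Longrightarrow> prob_space (K x)" and sets_K: "x \<in> V \<Longrightarrow> sets (K x) = sets N"
  using kernel vertices_subset_cube by blast+

lemma measurable_K: "x \<in> V \<Longrightarrow> measurable (K x) L = measurable N L"
  using sets_K by (intro measurable_cong_sets) auto

lemma measurable_XZ:
  "(\<And>x. x \<in> V \<Longrightarrow> (\<lambda>z. f (x, z)) \<in> measurable N L) \<Longrightarrow> f \<in> measurable XZ L"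
  by (intro measurable_pair_measure_countable1) (auto simp: countable_finite)

lemma measurable_XZ_section: "f \<in> measurable XZ L \<Longrightarrow> x \<in> V \<Longrightarrow> (\<lambda>z. f (x, z)) \<in> measurable N L"
  by (rule measurable_compose[OF measurable_Pair1']) auto

lemma kernel_joint:
  "(\<lambda>x. distr (K x) XZ (Pair x)) \<in> uniform_count_measure V \<rightarrow>\<^sub>M subprob_algebra XZ"
proof -
  have "distr (K x) XZ (Pair x) \<in> space (subprob_algebra XZ)" if x: "x \<in> V" for x
  proof -
    have "Pair x \<in> K x \<rightarrow>\<^sub>M XZ" using x by (simp add: measurable_K)
    then have "prob_space (distr (K x) XZ (Pair x))" by (rule prob_space.prob_space_distr[OF prob_K[OF x]])
    then show ?thesis by (simp add: space_subprob_algebra prob_space_imp_subprob_space)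
  qed
  then show ?thesis
    by (subst measurable_cong_sets[OF sets_uniform_count_measure_count_space refl]) (simp add: measurable_count_space_eq1)
qed

lemma sets_joint[measurable_cong, simp]: "sets J = sets XZ"
  unfolding joint_law_def by (intro sets_bind) (auto simp: space_uniform_count_measure)

lemma space_joint: "space J = V \<times> space N"
  using sets_eq_imp_space_eq[OF sets_joint] by (simp add: space_pair_measure)

lemma nn_integral_joint:
  assumes F: "F \<in> borel_measurable XZ"
  shows "(\<integral>\<^sup>+p. F p \<partial>J) = (\<Sum>x\<in>V. w * (\<integral>\<^sup>+z. F (x, z) \<partial>K x))"
proof -
  have "(\<integral>\<^sup>+p. F p \<partial>J) = (\<integral>\<^sup>+x. \<integral>\<^sup>+p. F p \<partial>distr (K x) XZ (Pair x) \<partial>uniform_count_measure V)"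
    unfolding joint_law_def by (rule nn_integral_bind[OF F kernel_joint])
  also have "\<dots> = (\<Sum>x\<in>V. w * (\<integral>\<^sup>+p. F p \<partial>distr (K x) XZ (Pair x)))"
    by (simp add: uniform_count_measure_def nn_integral_point_measure_finite card_vertices)
  also have "\<dots> = (\<Sum>x\<in>V. w * (\<integral>\<^sup>+z. F (x, z) \<partial>K x))"
    using F by (intro sum.cong refl arg_cong2[where f="(*)"] nn_integral_distr) (auto simp: measurable_K)
  finally show ?thesis .
qed

lemma w_sum: "(\<Sum>x\<in>V. w * c) = c"
  by (simp add: card_vertices mult.assoc[symmetric] ennreal_of_nat_eq_real_of_nat ennreal_mult[symmetric])

lemma prob_joint: "prob_space J"
proof
  have "emeasure J (space J) = (\<integral>\<^sup>+p. 1 \<partial>J)" by simp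
  also have "\<dots> = (\<Sum>x\<in>V. w * (\<integral>\<^sup>+z. 1 \<partial>K x))" by (rule nn_integral_joint) simp
  also have "\<dots> = (\<Sum>x\<in>V. w * 1)"
    by (intro sum.cong refl) (simp add: prob_space.emeasure_space_1[OF prob_K])
  finally show "emeasure J (space J) = 1" using w_sum[of 1] by simp
qed

sublocale J: prob_space J by (rule prob_joint)

sublocale J: information_space J 2 by unfold_locales simp

abbreviation "PX \<equiv> distr J (count_space V) fst"
abbreviation "PZ \<equiv> distr J N snd"

lemma prob_PX: "prob_space PX" and prob_PZ: "prob_space PZ"
  by (auto intro!: J.prob_space_distr)

text \<open>
  Fubini's theorem reduces to a function of \<open>x\<close> integrated over \<open>PX\<close>; pulled back to the joint
  law, it is constant in \<open>z\<close>, and each \<open>K x\<close> has mass 1.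
\<close>
lemma nn_integral_product:
  assumes F: "F \<in> borel_measurable XZ"
  shows "(\<integral>\<^sup>+p. F p \<partial>(PX \<Otimes>\<^sub>M PZ)) = (\<Sum>x\<in>V. w * (\<integral>\<^sup>+z. F (x, z) \<partial>PZ))"
proof -
  interpret PZ: prob_space PZ by (rule prob_PZ)
  have F': "F \<in> borel_measurable (PX \<Otimes>\<^sub>M PZ)" using F by simp
  have "(\<integral>\<^sup>+p. F p \<partial>(PX \<Otimes>\<^sub>M PZ)) = (\<integral>\<^sup>+x. \<integral>\<^sup>+z. F (x, z) \<partial>PZ \<partial>PX)"
    by (rule PZ.nn_integral_fst[OF F', symmetric])
  also have "\<dots> = (\<integral>\<^sup>+p. (\<integral>\<^sup>+z. F (fst p, z) \<partial>PZ) \<partial>J)"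
    by (rule nn_integral_distr) auto
  also have "\<dots> = (\<Sum>x\<in>V. w * (\<integral>\<^sup>+z'. (\<integral>\<^sup>+z. F (x, z) \<partial>PZ) \<partial>K x))"
    by (subst nn_integral_joint) (auto intro!: measurable_XZ)
  also have "\<dots> = (\<Sum>x\<in>V. w * (\<integral>\<^sup>+z. F (x, z) \<partial>PZ))"
    by (intro sum.cong refl) (simp add: prob_space.emeasure_space_1[OF prob_K])
  finally show ?thesis .
qed

lemma emeasure_joint: "A \<in> sets XZ \<Longrightarrow> emeasure J A = (\<Sum>x\<in>V. w * emeasure (K x) (Pair x -` A))"
proof -
  assume A: "A \<in> sets XZ"
  have "emeasure J A = (\<integral>\<^sup>+p. indicator A p \<partial>J)" using A by simp
  also have "\<dots> = (\<Sum>x\<in>V. w * (\<integral>\<^sup>+z. indicator A (x, z) \<partial>K x))" using A by (intro nn_integral_joint) simp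
  also have "\<dots> = (\<Sum>x\<in>V. w * (\<integral>\<^sup>+z. indicator (Pair x -` A) z \<partial>K x))" by (simp add: indicator_def)
  also have "\<dots> = (\<Sum>x\<in>V. w * emeasure (K x) (Pair x -` A))"
    using A by (intro sum.cong refl) (simp add: sets_K sets_Pair1)
  finally show ?thesis .
qed

lemma emeasure_product: "A \<in> sets XZ \<Longrightarrow> emeasure (PX \<Otimes>\<^sub>M PZ) A = (\<Sum>x\<in>V. w * emeasure PZ (Pair x -` A))"
proof -
  assume A: "A \<in> sets XZ"
  have "emeasure (PX \<Otimes>\<^sub>M PZ) A = (\<integral>\<^sup>+p. indicator A p \<partial>(PX \<Otimes>\<^sub>M PZ))" using A by simp
  also have "\<dots> = (\<Sum>x\<in>V. w * (\<integral>\<^sup>+z. indicator A (x, z) \<partial>PZ))" using A by (intro nn_integral_product) simp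
  also have "\<dots> = (\<Sum>x\<in>V. w * (\<integral>\<^sup>+z. indicator (Pair x -` A) z \<partial>PZ))" by (simp add: indicator_def)
  also have "\<dots> = (\<Sum>x\<in>V. w * emeasure PZ (Pair x -` A))"
    using A by (intro sum.cong refl) (simp add: sets_Pair1)
  finally show ?thesis .
qed

text \<open>
  \<open>PZ\<close> is the average of the \<open>2 ^ (t + 2)\<close> measures \<open>K x\<close> over the vertices.
\<close>
lemma emeasure_K_le_PZ:
  assumes x: "x \<in> V" and B: "B \<in> sets N"
  shows "emeasure (K x) B \<le> ennreal (2 ^ (t+2)) * emeasure PZ B"
proof -
  have "emeasure PZ B = emeasure J (snd -` B \<inter> space J)" using B by (simp add: emeasure_distr)
  also have "\<dots> = (\<Sum>x\<in>V. w * emeasure (K x) (Pair x -` (snd -` B \<inter> space J)))"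
    using B by (intro emeasure_joint) (simp flip: sets_joint)
  also have "\<dots> \<ge> w * emeasure (K x) (Pair x -` (snd -` B \<inter> space J))"
    using x by (intro member_le_sum) auto
  also have "Pair x -` (snd -` B \<inter> space J) = B"
    using x sets.sets_into_space[OF B] by (auto simp: space_joint)
  finally have "ennreal (2 ^ (t+2)) * (w * emeasure (K x) B) \<le> ennreal (2 ^ (t+2)) * emeasure PZ B"
    by (rule mult_left_mono) simp
  moreover have "ennreal (2 ^ (t+2)) * w = 1"
    by (subst ennreal_mult[symmetric]) auto
  ultimately show ?thesis by (simp add: mult.assoc[symmetric])
qed

text \<open>
  This domination supplies the bounded density and so excludes an infinite information.
\<close>
lemma joint_le_product:
  assumes A: "A \<in> sets XZ"
  shows "emeasure J A \<le> ennreal (2 ^ (t+2)) * emeasure (PX \<Otimes>\<^sub>M PZ) A"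
proof -
  have "emeasure J A = (\<Sum>x\<in>V. w * emeasure (K x) (Pair x -` A))" by (rule emeasure_joint[OF A])
  also have "\<dots> \<le> (\<Sum>x\<in>V. w * (ennreal (2 ^ (t+2)) * emeasure PZ (Pair x -` A)))"
    using A by (intro sum_mono mult_left_mono emeasure_K_le_PZ) (auto simp: sets_Pair1)
  also have "\<dots> = ennreal (2 ^ (t+2)) * emeasure (PX \<Otimes>\<^sub>M PZ) A"
    by (simp only: emeasure_product[OF A] sum_distrib_left mult.left_commute)
  finally show ?thesis .
qed

lemma prob_product: "prob_space (PX \<Otimes>\<^sub>M PZ)"
proof -
  interpret PX: prob_space PX by (rule prob_PX)
  interpret PZ: prob_space PZ by (rule prob_PZ)
  interpret pair_prob_space PX PZ ..
  show ?thesis by unfold_locales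
qed

lemma joint_density:
  obtains f where "f \<in> borel_measurable (PX \<Otimes>\<^sub>M PZ)" "\<And>p. 0 \<le> f p" "\<And>p. f p \<le> 2 ^ (t+2)"
    "J = density (PX \<Otimes>\<^sub>M PZ) (\<lambda>p. ennreal (f p))"
proof -
  have s: "sets (PX \<Otimes>\<^sub>M PZ) = sets XZ" by (intro sets_pair_measure_cong) auto
  show thesis
    by (rule bounded_density_exists[OF prob_product prob_joint, of "2 ^ (t+2)"])
      (use joint_le_product that s in auto)
qed

lemma memory_information_eq: "memory_information t N K = KL_divergence 2 (PX \<Otimes>\<^sub>M PZ) J"
proof -
  have "distr J XZ (\<lambda>p. (fst p, snd p)) = J"
    by (simp add: distr_id2)
  then show ?thesis by (simp add: memory_information_def J.mutual_information_def)
qed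

lemma error_set_measurable:
  assumes "decision_rule t N \<delta>" "i < t+2"
  shows "{p \<in> space J. \<delta> i (snd p) \<noteq> (center i < fst p i)} \<in> sets J"
proof -
  have [measurable]: "Measurable.pred N (\<delta> i)" using assms by (simp add: decision_rule_def)
  have "Measurable.pred XZ (\<lambda>p. \<delta> i (snd p) \<noteq> (center i < fst p i))"
    by (rule measurable_XZ) simp
  then show ?thesis by (simp add: pred_def sets_eq_imp_space_eq[OF sets_joint])
qed

text \<open>
  The test density assumes independent errors of probability \<open>p\<close>. Its logarithm is
  \<open>n (1 + log\<^sub>2 (1 - p))\<close> plus \<open>log\<^sub>2 p - log\<^sub>2 (1 - p)\<close> for each wrong decision, hence its mean sees
  only the average error. Strict bounds on \<open>p\<close> keep \<open>g\<close> away from 0.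
\<close>
lemma information_ge_test:
  assumes \<delta>: "decision_rule t N \<delta>" and p: "0 < p" "p < 1"
  defines "q \<equiv> average_decision_error t N K \<delta>"
  shows "real (t+2) * (1 + q * log 2 p + (1 - q) * log 2 (1 - p)) \<le> memory_information t N K"
proof -
  let ?n = "t+2"
  let ?wrong = "\<lambda>i pz. \<delta> i (snd pz) \<noteq> (center i < fst pz i)"
  define W where "W i = {pz \<in> space J. ?wrong i pz}" for i
  have W[measurable]: "W i \<in> sets J" if "i < ?n" for i
    unfolding W_def by (rule error_set_measurable[OF \<delta> that])
  have q: "(\<Sum>i<?n. measure J (W i)) = real ?n * q"
    by (simp add: q_def average_decision_error_def W_def)
  define g where "g pz = 2 ^ ?n * (\<Prod>i<?n. if ?wrong i pz then p else 1 - p)" for pz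
  \<comment> \<open>Crude bounds on the test density, needed for integrability of its logarithm only.\<close>
  define m where "m = min p (1 - p)"
  have m: "0 < m" using p by (simp add: m_def)
  have lo: "2 ^ ?n * m ^ ?n \<le> g pz" for pz
  proof -
    have "(\<Prod>i<?n. m) \<le> (\<Prod>i<?n. if ?wrong i pz then p else 1 - p)"
      using p m by (intro prod_mono) (auto simp: m_def)
    then show ?thesis by (simp add: g_def)
  qed
  have hi: "g pz \<le> 2 ^ ?n" for pz
  proof -
    have "(\<Prod>i<?n. if ?wrong i pz then p else 1 - p) \<le> (\<Prod>i<?n. 1)"
      using p by (intro prod_mono) auto
    then show ?thesis by (simp add: g_def)
  qed
  have g0: "0 < g pz" for pz using lo[of pz] m by (meson less_le_trans mult_pos_pos zero_less_numeral zero_less_power)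
  have g_XZ: "g \<in> borel_measurable XZ"
  proof (rule measurable_XZ)
    fix x assume "x \<in> V"
    have [measurable]: "Measurable.pred N (\<delta> i)" if "i < ?n" for i using \<delta> that by (simp add: decision_rule_def)
    show "(\<lambda>z. g (x, z)) \<in> borel_measurable N"
      unfolding g_def by (intro borel_measurable_times borel_measurable_prod borel_measurable_const) simp
  qed
  then have gm: "g \<in> borel_measurable (PX \<Otimes>\<^sub>M PZ)" by simp
  have "(\<integral>\<^sup>+pz. ennreal (g pz) \<partial>(PX \<Otimes>\<^sub>M PZ)) = (\<Sum>x\<in>V. w * (\<integral>\<^sup>+z. ennreal (g (x, z)) \<partial>PZ))"
    using g_XZ by (intro nn_integral_product) simp
  also have "\<dots> = (\<integral>\<^sup>+z. (\<Sum>x\<in>V. w * ennreal (g (x, z))) \<partial>PZ)"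
    using measurable_XZ_section[OF g_XZ]
    by (subst nn_integral_sum) (auto intro!: sum.cong simp: nn_integral_cmult)
  also have "\<dots> = (\<integral>\<^sup>+z. 1 \<partial>PZ)"
  proof (intro nn_integral_cong)
    fix z
    have "w * ennreal (g (x, z)) = ennreal (1 / 2 ^ ?n * g (x, z))" for x
      using g0 by (intro ennreal_mult[symmetric]) (auto simp: less_imp_le)
    then have "(\<Sum>x\<in>V. w * ennreal (g (x, z))) = ennreal (\<Sum>x\<in>V. 1 / 2 ^ ?n * g (x, z))"
      using g0 by (simp only:) (intro sum_ennreal, auto simp: less_imp_le)
    also have "(\<Sum>x\<in>V. 1 / 2 ^ ?n * g (x, z)) = (\<Sum>x\<in>V. \<Prod>i<?n. if \<delta> i z \<noteq> (center i < x i) then p else 1 - p)"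
      by (simp add: g_def)
    finally show "(\<Sum>x\<in>V. w * ennreal (g (x, z))) = 1" by (simp only: sum_vertices_prod ennreal_1)
  qed
  also have "\<dots> = 1" using prob_space.emeasure_space_1[OF prob_PZ] by simp
  finally have "(\<integral>pz. g pz \<partial>(PX \<Otimes>\<^sub>M PZ)) = 1"
    using gm g0 by (subst integral_eq_nn_integral) (auto simp: less_imp_le)
  then have g1: "(\<integral>pz. g pz \<partial>(PX \<Otimes>\<^sub>M PZ)) \<le> 1" by simp
  obtain f where f: "f \<in> borel_measurable (PX \<Otimes>\<^sub>M PZ)" "\<And>p. 0 \<le> f p" "\<And>p. f p \<le> 2 ^ ?n"
    "J = density (PX \<Otimes>\<^sub>M PZ) (\<lambda>p. ennreal (f p))"
    by (rule joint_density) (rule that)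
  have "prob_space (density (PX \<Otimes>\<^sub>M PZ) (\<lambda>p. ennreal (f p)))"
    unfolding f(4)[symmetric] by (rule prob_joint)
  from KL_divergence_ge[OF prob_product this f(1-3) gm _ lo hi g1]
  have "(\<integral>pz. log 2 (g pz) \<partial>J) \<le> memory_information t N K"
    unfolding f(4)[symmetric] memory_information_eq using m by simp
  moreover have "(\<integral>pz. log 2 (g pz) \<partial>J)
      = (\<integral>pz. real ?n * (1 + log 2 (1 - p)) + (\<Sum>i<?n. indicator (W i) pz * (log 2 p - log 2 (1 - p))) \<partial>J)"
  proof (rule Bochner_Integration.integral_cong[OF refl])
    fix pz assume pz: "pz \<in> space J"
    let ?P = "\<Prod>i<?n. if ?wrong i pz then p else 1 - p"
    have "0 < ?P" using p by (intro prod_pos) auto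
    then have "ln (g pz) = ln (2 ^ ?n) + ln ?P" unfolding g_def by (intro ln_mult_pos) auto
    also have "ln ((2::real) ^ ?n) = real ?n * ln 2" by (rule ln_realpow)
    also have "ln ?P = (\<Sum>i<?n. ln (if ?wrong i pz then p else 1 - p))"
      using p by (intro ln_prod) auto
    finally have "ln (g pz) = real ?n * ln 2 + (\<Sum>i<?n. ln (if ?wrong i pz then p else 1 - p))" .
    then have "log 2 (g pz) = real ?n + (\<Sum>i<?n. log 2 (if ?wrong i pz then p else 1 - p))"
      by (simp add: log_def add_divide_distrib sum_divide_distrib)
    also have "(\<Sum>i<?n. log 2 (if ?wrong i pz then p else 1 - p))
        = (\<Sum>i<?n. log 2 (1 - p) + indicator (W i) pz * (log 2 p - log 2 (1 - p)))"
      using pz by (intro sum.cong) (auto simp: W_def)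
    finally show "log 2 (g pz) = real ?n * (1 + log 2 (1 - p)) + (\<Sum>i<?n. indicator (W i) pz * (log 2 p - log 2 (1 - p)))"
      by (simp only: sum.distrib sum_constant card_lessThan distrib_left mult_1_right add.assoc)
  qed
  moreover have "\<dots> = real ?n * (1 + log 2 (1 - p)) + (\<Sum>i<?n. measure J (W i) * (log 2 p - log 2 (1 - p)))"
  proof -
    have ind: "integrable J (\<lambda>pz. indicator (W i) pz * (log 2 p - log 2 (1 - p)))"
      and ind_eq: "(\<integral>pz. indicator (W i) pz * (log 2 p - log 2 (1 - p)) \<partial>J) = measure J (W i) * (log 2 p - log 2 (1 - p))"
      if "i \<in> {..<?n}" for i
      using W[of i] that by (auto simp: less_top[symmetric] J.emeasure_eq_measure)
    show ?thesis
      by (simp only: Bochner_Integration.integral_add[OF J.integrable_const Bochner_Integration.integrable_sum[OF ind]]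
          Bochner_Integration.integral_sum[OF ind] ind_eq cong: sum.cong) (simp add: J.prob_space)
  qed
  moreover have "\<dots> = real ?n * (1 + log 2 (1 - p)) + real ?n * q * (log 2 p - log 2 (1 - p))"
    by (simp only: sum_distrib_right[symmetric] q)
  moreover have "\<dots> = real ?n * (1 + q * log 2 p + (1 - q) * log 2 (1 - p))"
    by (simp add: algebra_simps)
  ultimately show ?thesis by simp
qed

lemma average_decision_error_nonneg: "0 \<le> average_decision_error t N K \<delta>"
  by (simp add: average_decision_error_def sum_nonneg)

text \<open>
  For positive average error the best parameter \<open>p\<close> is that error itself; for zero error it is
  the limit of \<open>p\<close> towards 0.
\<close>
lemma information_ge:
  assumes \<delta>: "decision_rule t N \<delta>" and half: "average_decision_error t N K \<delta> \<le> 1/2"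
  shows "real (t+2) * (1 - h2 (average_decision_error t N K \<delta>)) \<le> memory_information t N K"
proof (cases "average_decision_error t N K \<delta> = 0")
  case False
  then have "0 < average_decision_error t N K \<delta>" using average_decision_error_nonneg[of \<delta>] by simp
  then show ?thesis using information_ge_test[OF \<delta>, of "average_decision_error t N K \<delta>"] half
    by (simp add: h2_def algebra_simps)
next
  case True
  have "real (t+2) * (1 + log 2 (1 - p)) \<le> memory_information t N K" if "0 < p" "p < 1" for p
    using information_ge_test[OF \<delta> that] True by simp
  then have ev: "\<forall>\<^sub>F p in at_right 0. real (t+2) * (1 + log 2 (1 - p)) \<le> memory_information t N K"
    unfolding eventually_at_right_field by (intro exI[of _ 1]) auto
  have "((\<lambda>p. real (t+2) * (1 + log 2 (1 - p))) \<longlongrightarrow> real (t+2) * (1 + log 2 (1 - 0))) (at_right 0)"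
    by (intro tendsto_intros) auto
  from tendsto_upperbound[OF this ev] show ?thesis by (simp add: True h2_0)
qed

text \<open>
  The parameter \<open>p = 1/2\<close> makes the test density constant, whatever the decision rule.
\<close>
lemma memory_information_nonneg: "0 \<le> memory_information t N K"
  using information_ge_test[of "\<lambda>_ _. True" "1/2"]
  by (simp add: decision_rule_def log_divide algebra_simps)

lemma error_ge:
  assumes \<delta>: "decision_rule t N \<delta>" and B: "memory_information t N K \<le> B"
  shows "h2_inv (max 0 (1 - B / real (t+2))) \<le> average_decision_error t N K \<delta>"
proof (rule h2_inv_le)
  show "max 0 (1 - B / real (t+2)) \<le> 1" using memory_information_nonneg B by simp
  show "max 0 (1 - B / real (t+2)) \<le> h2 (average_decision_error t N K \<delta>)"
    if half: "average_decision_error t N K \<delta> \<le> 1/2"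
  proof -
    have "0 \<le> h2 (average_decision_error t N K \<delta>)"
      using h2_mono[OF order_refl average_decision_error_nonneg half] by (simp add: h2_0)
    moreover have "real (t+2) * (1 - h2 (average_decision_error t N K \<delta>)) \<le> B"
      using information_ge[OF \<delta> half] B by simp
    then have "1 - B / real (t+2) \<le> h2 (average_decision_error t N K \<delta>)" by (simp add: field_simps)
    ultimately show ?thesis by simp
  qed
qed (auto simp: average_decision_error_nonneg)

end

section \<open>Information and entropy\<close>

text \<open>
  The density of the joint law at \<open>(x, z)\<close> is \<open>K x {z} / PZ {z}\<close>, at most \<open>1 / PZ {z}\<close>. Taking
  expected logarithms gives \<open>I(X;Z) \<le> H(Z)\<close>, where finite entropy guarantees integrability.
\<close>
lemma memory_information_le_entropy:
  assumes enc: "encoder t (count_space C) K" and C: "countable C"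
    and \<phi>: "information_space.finite_entropy (joint_law t (count_space C) K) 2 (count_space C) snd \<phi>"
  shows "memory_information t (count_space C) K
    \<le> prob_space.entropy (joint_law t (count_space C) K) 2 (count_space C) snd"
proof -
  interpret memory t "count_space C" K by unfold_locales (rule enc)
  have dist: "distributed J (count_space C) snd (\<lambda>z. ennreal (\<phi> z))"
    and \<phi>int: "integrable (count_space C) (\<lambda>z. \<phi> z * log 2 (\<phi> z))"
    and \<phi>0: "\<And>z. z \<in> C \<Longrightarrow> 0 \<le> \<phi> z"
    using \<phi> by (auto simp: J.finite_entropy_def)
  have PZ: "PZ = density (count_space C) (\<lambda>z. ennreal (\<phi> z))"
    by (rule distributed_distr_eq_density[OF dist])
  obtain f where f: "f \<in> borel_measurable (PX \<Otimes>\<^sub>M PZ)" "\<And>p. 0 \<le> f p" "\<And>p. f p \<le> 2 ^ (t+2)"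
    "J = density (PX \<Otimes>\<^sub>M PZ) (\<lambda>p. ennreal (f p))"
    by (rule joint_density) (rule that)
  note f(1)[measurable]
  interpret PXZ: prob_space "PX \<Otimes>\<^sub>M PZ" by (rule prob_product)
  have flogf: "integrable (PX \<Otimes>\<^sub>M PZ) (\<lambda>p. f p * log 2 (f p))"
    using f(1-3) by (rule PXZ.integrable_bounded_mult_log)
  have f_le: "f (x, z) * \<phi> z \<le> 1" if xz: "x \<in> V" "z \<in> C" for x z
  proof -
    have A: "{(x, z)} \<in> sets XZ" using xz pair_measureI[of "{x}" "count_space V" "{z}" "count_space C"] by simp
    have pre: "Pair x' -` {(x, z)} = (if x' = x then {z} else {})" for x' by auto
    have single: "(\<Sum>x'\<in>V. w * emeasure (M x') (Pair x' -` {(x, z)})) = w * emeasure (M x) {z}" for M :: "_ \<Rightarrow> _ measure"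
    proof -
      have "(\<Sum>x'\<in>V. w * emeasure (M x') (Pair x' -` {(x, z)})) = (\<Sum>x'\<in>V. if x' = x then w * emeasure (M x) {z} else 0)"
        unfolding pre by (intro sum.cong) auto
      then show ?thesis using xz by simp
    qed
    have "emeasure PZ {z} = (\<integral>\<^sup>+z'. ennreal (\<phi> z) * indicator {z} z' \<partial>count_space C)"
      using xz by (simp add: PZ emeasure_density)
    also have "\<dots> = ennreal (\<phi> z)" using xz by (simp add: nn_integral_cmult_indicator)
    finally have PZz: "emeasure PZ {z} = ennreal (\<phi> z)" .
    have "emeasure J {(x, z)} = (\<integral>\<^sup>+p. ennreal (f p) * indicator {(x, z)} p \<partial>(PX \<Otimes>\<^sub>M PZ))"
      using A by (subst f(4)) (simp add: emeasure_density)
    also have "\<dots> = (\<integral>\<^sup>+p. ennreal (f (x, z)) * indicator {(x, z)} p \<partial>(PX \<Otimes>\<^sub>M PZ))"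
      by (intro nn_integral_cong) (auto split: split_indicator)
    also have "\<dots> = ennreal (f (x, z)) * emeasure (PX \<Otimes>\<^sub>M PZ) {(x, z)}"
      using A by (intro nn_integral_cmult_indicator) simp
    also have "emeasure (PX \<Otimes>\<^sub>M PZ) {(x, z)} = w * ennreal (\<phi> z)"
      using emeasure_product[OF A] single[of "\<lambda>_. PZ"] PZz by simp
    finally have "emeasure J {(x, z)} = ennreal (f (x, z)) * (w * ennreal (\<phi> z))" .
    moreover have "emeasure J {(x, z)} = w * emeasure (K x) {z}"
      using emeasure_joint[OF A] single[of K] by simp
    moreover have "w * emeasure (K x) {z} \<le> w * 1"
      using prob_space.measure_le_1[OF prob_K[OF xz(1)]] by (intro mult_left_mono) auto
    ultimately have "ennreal (f (x, z)) * (w * ennreal (\<phi> z)) \<le> w" by simp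
    moreover have "ennreal (f (x, z)) * (w * ennreal (\<phi> z)) = ennreal (f (x, z) * (1 / 2 ^ (t+2) * \<phi> z))"
      using f(2) \<phi>0[OF xz(2)] by (simp only: ennreal_mult[symmetric] divide_nonneg_nonneg mult_nonneg_nonneg zero_le_one zero_le_power zero_le_numeral)
    ultimately have "f (x, z) * (1 / 2 ^ (t+2) * \<phi> z) \<le> 1 / 2 ^ (t+2)" by (simp only:) (subst (asm) ennreal_le_iff, auto)
    then show ?thesis by (simp add: field_simps)
  qed
  have log\<phi>_int: "integrable J (\<lambda>p. log 2 (\<phi> (snd p)))"
    using distributed_integrable[OF dist, of "\<lambda>z. log 2 (\<phi> z)"] \<phi>int \<phi>0 by simp
  have logf_int: "integrable J (\<lambda>p. log 2 (f p))"
    by (subst f(4)) (use f(2) flogf in \<open>simp add: integrable_density\<close>)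
  have "AE p in density (PX \<Otimes>\<^sub>M PZ) (\<lambda>p. ennreal (f p)). 0 < f p"
    by (subst AE_density) auto
  then have fpos: "AE p in J. 0 < f p" unfolding f(4)[symmetric] .
  have "AE z in PZ. 0 < \<phi> z"
    unfolding PZ by (subst AE_density) auto
  then have \<phi>pos: "AE p in J. 0 < \<phi> (snd p)" by (rule AE_distrD[rotated]) simp
  have "memory_information t (count_space C) K = (\<integral>p. f p * log 2 (f p) \<partial>(PX \<Otimes>\<^sub>M PZ))"
    unfolding memory_information_eq by (subst (3) f(4)) (use f(2) in \<open>auto intro!: PXZ.KL_density\<close>)
  also have "\<dots> = (\<integral>p. log 2 (f p) \<partial>density (PX \<Otimes>\<^sub>M PZ) (\<lambda>p. ennreal (f p)))"
    using f(2) by (subst integral_density) auto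
  also have "\<dots> = (\<integral>p. log 2 (f p) \<partial>J)" unfolding f(4)[symmetric] ..
  also have "\<dots> \<le> (\<integral>p. - log 2 (\<phi> (snd p)) \<partial>J)"
  proof (rule integral_mono_AE)
    show "AE p in J. log 2 (f p) \<le> - log 2 (\<phi> (snd p))"
      using fpos \<phi>pos AE_space
    proof eventually_elim
      case (elim p)
      then have "f p * \<phi> (snd p) \<le> 1" using f_le[of "fst p" "snd p"] by (auto simp: space_joint)
      then have "log 2 (f p * \<phi> (snd p)) \<le> log 2 1" using elim by (intro log_mono) auto
      then show ?case using elim by (simp add: log_mult)
    qed
  qed (use logf_int log\<phi>_int in auto)
  also have "\<dots> = - (\<integral>z. \<phi> z * log 2 (\<phi> z) \<partial>count_space C)"
    using distributed_integral[OF dist, of "\<lambda>z. log 2 (\<phi> z)"] \<phi>0 by simp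
  also have "\<dots> = J.entropy 2 (count_space C) snd"
    using \<phi>0 by (intro J.entropy_distr[OF dist, symmetric]) simp
  finally show ?thesis .
qed

section \<open>Risks\<close>

definition threshold :: "('z \<Rightarrow> nat \<Rightarrow> real) \<Rightarrow> nat \<Rightarrow> 'z \<Rightarrow> bool" where
  "threshold D i z \<longleftrightarrow> center i < D z i"

lemma decision_rule_threshold: "decoder t N D \<Longrightarrow> decision_rule t N (threshold D)"
  unfolding decoder_def decision_rule_def threshold_def by auto

context memory
begin

lemma uniform_risk_le_worst_risk:
  assumes "(\<lambda>p. L (snd p) (fst p)) \<in> borel_measurable XZ"
  shows "uniform_risk t N K L \<le> worst_risk t K L"
proof -
  have "uniform_risk t N K L = (\<Sum>x\<in>V. w * conditional_risk K L x)"
    unfolding uniform_risk_def conditional_risk_def using nn_integral_joint[OF assms] by simp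
  also have "\<dots> \<le> (\<Sum>x\<in>V. w * worst_risk t K L)"
    unfolding worst_risk_def using vertices_subset_cube
    by (intro sum_mono mult_left_mono SUP_upper) auto
  also have "\<dots> = worst_risk t K L" by (rule w_sum)
  finally show ?thesis .
qed

lemma decision_loss_vertex:
  assumes "x \<in> V"
  shows "decision_loss t \<delta> z x = ennreal ((\<Sum>i<t+2. of_bool (\<delta> i z \<noteq> (center i < x i))) / real (t+2))"
proof -
  have "x i \<noteq> center i" if "i < t+2" for i using assms that by (auto simp: vertices_def)
  then have "{i\<in>{..<t+2}. \<delta> i z \<and> x i < center i \<or> \<not> \<delta> i z \<and> center i < x i} = {..<t+2} \<inter> {i. \<delta> i z \<noteq> (center i < x i)}"
    by force
  then show ?thesis by (simp only: decision_loss_def sum_of_bool_eq finite_lessThan)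
qed

lemma decision_rule_pred: "decision_rule t N \<delta> \<Longrightarrow> i < t+2 \<Longrightarrow> Measurable.pred N (\<delta> i)"
  by (simp add: decision_rule_def)

lemma decision_loss_measurable:
  assumes "decision_rule t N \<delta>"
  shows "(\<lambda>p. decision_loss t \<delta> (snd p) (fst p)) \<in> borel_measurable XZ"
proof (rule measurable_XZ)
  fix x assume x: "x \<in> V"
  note decision_rule_pred[OF assms, measurable]
  have "(\<lambda>z. \<Sum>i<t+2. of_bool (\<delta> i z \<noteq> (center i < x i)) :: real) \<in> borel_measurable N"
    by (intro borel_measurable_sum) (simp add: of_bool_def)
  then show "(\<lambda>z. decision_loss t \<delta> (snd (x, z)) (fst (x, z))) \<in> borel_measurable N"
    unfolding fst_conv snd_conv decision_loss_vertex[OF x]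
    by (intro measurable_compose[OF _ measurable_ennreal] borel_measurable_divide borel_measurable_const)
qed

lemma uniform_risk_decision:
  assumes \<delta>: "decision_rule t N \<delta>"
  shows "uniform_risk t N K (decision_loss t \<delta>) = ennreal (average_decision_error t N K \<delta>)"
proof -
  define W where "W i = {p \<in> space J. \<delta> i (snd p) \<noteq> (center i < fst p i)}" for i
  have W: "W i \<in> sets J" if "i < t+2" for i unfolding W_def by (rule error_set_measurable[OF \<delta> that])
  have int: "integrable J (\<lambda>p. (\<Sum>i<t+2. indicator (W i) p) / real (t+2))"
    using W by (intro integrable_divide Bochner_Integration.integrable_sum integrable_real_indicator)
      (auto simp: J.emeasure_eq_measure)
  have "uniform_risk t N K (decision_loss t \<delta>) = (\<integral>\<^sup>+p. ennreal ((\<Sum>i<t+2. indicator (W i) p) / real (t+2)) \<partial>J)"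
    unfolding uniform_risk_def
  proof (intro nn_integral_cong)
    fix p assume p: "p \<in> space J"
    then have "fst p \<in> V" by (auto simp: space_joint)
    moreover have "(\<Sum>i<t+2. indicator (W i) p :: real) = (\<Sum>i<t+2. of_bool (\<delta> i (snd p) \<noteq> (center i < fst p i)))"
      using p by (intro sum.cong) (auto simp: W_def)
    ultimately show "decision_loss t \<delta> (snd p) (fst p) = ennreal ((\<Sum>i<t+2. indicator (W i) p) / real (t+2))"
      by (simp only: decision_loss_vertex)
  qed
  also have "\<dots> = ennreal (\<integral>p. (\<Sum>i<t+2. indicator (W i) p) / real (t+2) \<partial>J)"
    using int by (rule nn_integral_eq_integral) (intro AE_I2 divide_nonneg_nonneg sum_nonneg, auto)
  also have "(\<integral>p. (\<Sum>i<t+2. indicator (W i) p) / real (t+2) \<partial>J) = (\<integral>p. (\<Sum>i<t+2. indicator (W i) p) \<partial>J) / real (t+2)"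
    by (rule integral_divide_zero)
  also have "(\<integral>p. (\<Sum>i<t+2. indicator (W i) p) \<partial>J) = (\<Sum>i<t+2. measure J (W i))"
    using W by (subst Bochner_Integration.integral_sum)
      (auto simp: J.emeasure_eq_measure intro!: sum.cong integrable_real_indicator)
  finally show ?thesis by (simp only: average_decision_error_def W_def)
qed

lemma l1_dist_measurable:
  assumes "decoder t N D"
  shows "(\<lambda>p. l1_dist (t+2) (D (snd p)) (fst p)) \<in> borel_measurable XZ"
  using assms unfolding l1_dist_def
  by (intro measurable_XZ borel_measurable_sum) (auto simp: decoder_def)

lemma uniform_risk_recovery_eq:
  assumes "decoder t N D"
  shows "uniform_risk t N K (recovery_loss t D)
    = (\<integral>\<^sup>+ p. ennreal (l1_dist (t+2) (D (snd p)) (fst p)) \<partial>J) / of_nat (t+2)"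
proof -
  have "ennreal (l / real (t+2)) = ennreal l / of_nat (t+2)" if "0 \<le> l" for l
    using that by (subst divide_ennreal[symmetric]) (auto simp: ennreal_of_nat_eq_real_of_nat)
  then have "uniform_risk t N K (recovery_loss t D)
    = (\<integral>\<^sup>+ p. ennreal (l1_dist (t+2) (D (snd p)) (fst p)) / of_nat (t+2) \<partial>J)"
    by (simp only: uniform_risk_def recovery_loss_def l1_dist_def sum_nonneg abs_ge_zero)
  also have "\<dots> = (\<integral>\<^sup>+ p. ennreal (l1_dist (t+2) (D (snd p)) (fst p)) \<partial>J) / of_nat (t+2)"
    using l1_dist_measurable[OF assms] by (intro nn_integral_divide) simp
  finally show ?thesis .
qed

text \<open>
  At a vertex every coordinate is at distance \<open>1/8\<close> from its threshold, so a decoded value on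
  the wrong side is off by at least \<open>1/8\<close>.
\<close>
lemma uniform_risk_recovery_ge:
  assumes D: "decoder t N D"
  shows "ennreal (1/8 * average_decision_error t N K (threshold D)) \<le> uniform_risk t N K (recovery_loss t D)"
proof -
  have "ennreal (1/8 * average_decision_error t N K (threshold D))
      = ennreal (1/8) * uniform_risk t N K (decision_loss t (threshold D))"
    by (simp only: uniform_risk_decision[OF decision_rule_threshold[OF D]])
      (rule ennreal_mult, auto simp: average_decision_error_nonneg)
  also have "\<dots> = (\<integral>\<^sup>+p. ennreal (1/8) * decision_loss t (threshold D) (snd p) (fst p) \<partial>J)"
    unfolding uniform_risk_def
    using decision_loss_measurable[OF decision_rule_threshold[OF D]] by (intro nn_integral_cmult[symmetric]) simp
  also have "\<dots> \<le> uniform_risk t N K (recovery_loss t D)"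
    unfolding uniform_risk_def
  proof (rule nn_integral_mono)
    fix p assume "p \<in> space J"
    then obtain x z where p: "p = (x, z)" and x: "x \<in> V" by (auto simp: space_joint)
    have "1/8 * of_bool (threshold D i z \<noteq> (center i < x i)) \<le> \<bar>D z i - x i\<bar>" if "i < t+2" for i
    proof -
      have "\<bar>x i - center i\<bar> = 1/8" using x that by (simp add: vertices_def)
      then show ?thesis by (auto simp: threshold_def of_bool_def)
    qed
    then have "1/8 * (\<Sum>i<t+2. of_bool (threshold D i z \<noteq> (center i < x i))) \<le> l1_dist (t+2) (D z) x"
      unfolding l1_dist_def sum_distrib_left by (intro sum_mono) simp
    then have le: "1/8 * (\<Sum>i<t+2. of_bool (threshold D i z \<noteq> (center i < x i))) / real (t+2) \<le> l1_dist (t+2) (D z) x / real (t+2)"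
      by (rule divide_right_mono) simp
    have "0 \<le> (\<Sum>i<t+2. of_bool (threshold D i z \<noteq> (center i < x i)) :: real) / real (t+2)"
      by (intro divide_nonneg_nonneg sum_nonneg) auto
    then have "ennreal (1/8) * decision_loss t (threshold D) z x
        = ennreal (1/8 * ((\<Sum>i<t+2. of_bool (threshold D i z \<noteq> (center i < x i))) / real (t+2)))"
      unfolding decision_loss_vertex[OF x] by (intro ennreal_mult[symmetric]) auto
    also have "\<dots> \<le> recovery_loss t D z x"
      unfolding recovery_loss_def using le by (intro ennreal_leI) (simp only: times_divide_eq_right)
    finally show "ennreal (1/8) * decision_loss t (threshold D) (snd p) (fst p) \<le> recovery_loss t D (snd p) (fst p)"
      by (simp only: p fst_conv snd_conv)
  qed
  finally show ?thesis .
qed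

lemma recovery_loss_measurable:
  assumes "decoder t N D"
  shows "(\<lambda>p. recovery_loss t D (snd p) (fst p)) \<in> borel_measurable XZ"
  using l1_dist_measurable[OF assms] unfolding recovery_loss_def by simp

lemma uniform_recovery_ge:
  assumes D: "decoder t N D" and B: "memory_information t N K \<le> B"
  shows "ennreal (1/8 * h2_inv (max 0 (1 - B / real (t+2)))) \<le> uniform_risk t N K (recovery_loss t D)"
proof (rule order_trans[OF ennreal_leI uniform_risk_recovery_ge[OF D]])
  show "1/8 * h2_inv (max 0 (1 - B / real (t+2))) \<le> 1/8 * average_decision_error t N K (threshold D)"
    using error_ge[OF decision_rule_threshold[OF D] B] by (rule mult_left_mono) simp
qed

lemma uniform_decision_ge:
  assumes \<delta>: "decision_rule t N \<delta>" and B: "memory_information t N K \<le> B"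
  shows "ennreal (h2_inv (max 0 (1 - B / real (t+2)))) \<le> uniform_risk t N K (decision_loss t \<delta>)"
  unfolding uniform_risk_decision[OF \<delta>] using error_ge[OF \<delta> B] by (rule ennreal_leI)

lemmas worst_recovery_ge = order_trans[OF uniform_recovery_ge uniform_risk_le_worst_risk[OF recovery_loss_measurable]]
lemmas worst_decision_ge = order_trans[OF uniform_decision_ge uniform_risk_le_worst_risk[OF decision_loss_measurable]]

end

section \<open>Size of coordinate implementations\<close>

lemma coordinate_implementation_size:
  assumes impl: "coordinate_implementation t d b C K" and \<delta>: "decision_rule t (count_space C) \<delta>"
    and le: "average_decision_error t (count_space C) K \<delta> \<le> \<eta>" and \<eta>: "\<eta> < 1/2" and b: "b > 0"
  shows "(1 - h2 \<eta>) / b * real (t+2) \<le> real d"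
proof -
  interpret memory t "count_space C" K
    by unfold_locales (use impl in \<open>auto simp: coordinate_implementation_def\<close>)
  have "memory_information t (count_space C) K \<le> b * real d"
  proof -
    obtain \<phi> where "J.finite_entropy (count_space C) snd \<phi>"
      using impl by (auto simp: coordinate_implementation_def)
    then have "memory_information t (count_space C) K \<le> J.entropy 2 (count_space C) snd"
      using impl enc by (intro memory_information_le_entropy) (auto simp: coordinate_implementation_def)
    then show ?thesis using impl by (simp add: coordinate_implementation_def)
  qed
  moreover have "real (t+2) * (1 - h2 \<eta>) \<le> real (t+2) * (1 - h2 (average_decision_error t (count_space C) K \<delta>))"
    using h2_mono[OF average_decision_error_nonneg le] \<eta> by (intro mult_left_mono) auto
  moreover have "real (t+2) * (1 - h2 (average_decision_error t (count_space C) K \<delta>)) \<le> memory_information t (count_space C) K"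
    using le \<eta> by (intro information_ge[OF \<delta>]) simp
  ultimately have "real (t+2) * (1 - h2 \<eta>) \<le> b * real d" by linarith
  then show ?thesis using b by (simp add: field_simps)
qed

text \<open>
  Mean recovery error \<open>\<epsilon>\<close> forces average threshold error at most \<open>8 * \<epsilon>\<close>, which is below \<open>1/2\<close>
  exactly because \<open>\<epsilon> < 1/16\<close>.
\<close>
lemma coordinate_implementation_size_recovery:
  assumes impl: "coordinate_implementation t d b C K" and D: "decoder t (count_space C) D"
    and le: "uniform_risk t (count_space C) K (recovery_loss t D) \<le> ennreal \<epsilon>"
    and \<epsilon>: "0 \<le> \<epsilon>" "\<epsilon> < 1/16" and b: "b > 0"
  shows "(1 - h2 (8 * \<epsilon>)) / b * real (t+2) \<le> real d"
proof -
  interpret memory t "count_space C" K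
    by unfold_locales (use impl in \<open>auto simp: coordinate_implementation_def\<close>)
  have "ennreal (1/8 * average_decision_error t (count_space C) K (threshold D)) \<le> ennreal \<epsilon>"
    using uniform_risk_recovery_ge[OF D] le by (rule order_trans)
  then have "average_decision_error t (count_space C) K (threshold D) \<le> 8 * \<epsilon>"
    using \<epsilon> by (subst (asm) ennreal_le_iff) auto
  then show ?thesis
    using \<epsilon> by (intro coordinate_implementation_size[OF impl decision_rule_threshold[OF D] _ _ b]) auto
qed

section \<open>The cube bounds\<close>

theorem proposition7p6:
  fixes t :: nat and B b \<eta> \<epsilon> :: real
    and N :: "'z measure" and K :: "(nat \<Rightarrow> real) \<Rightarrow> 'z measure"
  assumes t: "t \<ge> 1"
    and K: "encoder t N K"
    and b: "b > 0"
    and \<eta>: "0 \<le> \<eta>" "\<eta> < 1/2"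
    and \<epsilon>: "0 \<le> \<epsilon>" "\<epsilon> < 1/16"
  shows
    \<comment> \<open>the cube is attainable\<close>
    "(\<exists>A \<Omega> \<P> R. one_decision_model t A \<Omega> \<P> \<and> cube t \<subseteq> attainable_vectors t A \<Omega> \<P> R)
   \<and> \<comment> \<open>bounds under the uniform distribution on the vertices\<close>
     (memory_information t N K \<le> B \<longrightarrow>
       (\<forall>D. decoder t N D \<longrightarrow>
         ennreal (1/8 * h2_inv (max 0 (1 - B / real (t+2))))
           \<le> (\<integral>\<^sup>+ p. ennreal (l1_dist (t+2) (D (snd p)) (fst p)) \<partial>joint_law t N K) / of_nat (t+2)) \<and>
       (\<forall>\<delta>. decision_rule t N \<delta> \<longrightarrow>
         h2_inv (max 0 (1 - B / real (t+2))) \<le> average_decision_error t N K \<delta>))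
   \<and> \<comment> \<open>size of coordinate implementations\<close>
     (\<forall>d (C :: 'c list set) K' \<delta>.
       coordinate_implementation t d b C K' \<longrightarrow> decision_rule t (count_space C) \<delta> \<longrightarrow>
       average_decision_error t (count_space C) K' \<delta> \<le> \<eta> \<longrightarrow>
       real d \<ge> real (t+2) * (1 - h2 \<eta>) / b)
   \<and> \<comment> \<open>worst conditional risk versus uniform risk, for an arbitrary loss\<close>
     (\<forall>L. (\<lambda>(x, z). L z x) \<in> borel_measurable (restrict_space borel (cube t) \<Otimes>\<^sub>M N) \<longrightarrow>
       uniform_risk t N K L \<le> worst_risk t K L)
   \<and> \<comment> \<open>minimax lower bounds\<close>
     (ennreal (1/8 * h2_inv (max 0 (1 - B / real (t+2))))
       \<le> (INF (N', K', D) \<in> {(N' :: 'z measure, K', D).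
             encoder t N' K' \<and> memory_information t N' K' \<le> B \<and> decoder t N' D}.
           worst_risk t K' (recovery_loss t D)))
   \<and> (ennreal (h2_inv (max 0 (1 - B / real (t+2))))
       \<le> (INF (N', K', \<delta>) \<in> {(N' :: 'z measure, K', \<delta>).
             encoder t N' K' \<and> memory_information t N' K' \<le> B \<and> decision_rule t N' \<delta>}.
           worst_risk t K' (decision_loss t \<delta>)))
   \<and> \<comment> \<open>the continuity criterion\<close>
     (\<forall>d E D. continuous_encoder t d E \<longrightarrow> d < t+2 \<longrightarrow> uniform_error t E D \<ge> 1/8)
   \<and> \<comment> \<open>linear memory: uniform recovery by continuous encoders\<close>
     requires_linear_memory 1
       (\<lambda>t d. \<exists>E D. continuous_encoder t d E \<and> uniform_error t E D < 1/8)
   \<and> \<comment> \<open>linear memory: average-case and minimax threshold decisions\<close>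
     requires_linear_memory ((1 - h2 \<eta>) / b)
       (\<lambda>t d. \<exists>(C :: 'c list set) K' \<delta>.
         coordinate_implementation t d b C K' \<and> decision_rule t (count_space C) \<delta> \<and>
         average_decision_error t (count_space C) K' \<delta> \<le> \<eta>)
   \<and> requires_linear_memory ((1 - h2 \<eta>) / b)
       (\<lambda>t d. \<exists>(C :: 'c list set) K' \<delta>.
         coordinate_implementation t d b C K' \<and> decision_rule t (count_space C) \<delta> \<and>
         worst_risk t K' (decision_loss t \<delta>) \<le> ennreal \<eta>)
   \<and> \<comment> \<open>linear memory: average-case and minimax recovery\<close>
     requires_linear_memory ((1 - h2 (8 * \<epsilon>)) / b)
       (\<lambda>t d. \<exists>(C :: 'c list set) K' D.
         coordinate_implementation t d b C K' \<and> decoder t (count_space C) D \<and>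
         uniform_risk t (count_space C) K' (recovery_loss t D) \<le> ennreal \<epsilon>)
   \<and> requires_linear_memory ((1 - h2 (8 * \<epsilon>)) / b)
       (\<lambda>t d. \<exists>(C :: 'c list set) K' D.
         coordinate_implementation t d b C K' \<and> decoder t (count_space C) D \<and>
         worst_risk t K' (recovery_loss t D) \<le> ennreal \<epsilon>)"
proof (intro conjI)
  show "\<exists>A \<Omega> \<P> R. one_decision_model t A \<Omega> \<P> \<and> cube t \<subseteq> attainable_vectors t A \<Omega> \<P> R"
    by (rule cube_attainable[OF t])
next
  show "memory_information t N K \<le> B \<longrightarrow>
       (\<forall>D. decoder t N D \<longrightarrow>
         ennreal (1/8 * h2_inv (max 0 (1 - B / real (t+2))))
           \<le> (\<integral>\<^sup>+ p. ennreal (l1_dist (t+2) (D (snd p)) (fst p)) \<partial>joint_law t N K) / of_nat (t+2)) \<and>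
       (\<forall>\<delta>. decision_rule t N \<delta> \<longrightarrow>
         h2_inv (max 0 (1 - B / real (t+2))) \<le> average_decision_error t N K \<delta>)"
    using memory.uniform_recovery_ge[OF memory.intro[OF K]] memory.error_ge[OF memory.intro[OF K]]
      memory.uniform_risk_recovery_eq[OF memory.intro[OF K]] by (metis (no_types))
next
  show "\<forall>d (C :: 'c list set) K' \<delta>.
       coordinate_implementation t d b C K' \<longrightarrow> decision_rule t (count_space C) \<delta> \<longrightarrow>
       average_decision_error t (count_space C) K' \<delta> \<le> \<eta> \<longrightarrow>
       real d \<ge> real (t+2) * (1 - h2 \<eta>) / b"
  proof (intro allI impI)
    fix d and C :: "'c list set" and K' \<delta>
    assume "coordinate_implementation t d b C K'" "decision_rule t (count_space C) \<delta>"
      "average_decision_error t (count_space C) K' \<delta> \<le> \<eta>"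
    then have "(1 - h2 \<eta>) / b * real (t+2) \<le> real d"
      by (rule coordinate_implementation_size[OF _ _ _ \<eta>(2) b])
    then show "real d \<ge> real (t+2) * (1 - h2 \<eta>) / b"
      by (simp only: times_divide_eq_left mult.commute[of "real (t+2)"])
  qed
next
  show "\<forall>L. (\<lambda>(x, z). L z x) \<in> borel_measurable (restrict_space borel (cube t) \<Otimes>\<^sub>M N) \<longrightarrow>
       uniform_risk t N K L \<le> worst_risk t K L"
  proof (intro allI impI)
    interpret memory t N K by (rule memory.intro[OF K])
    fix L :: "'z \<Rightarrow> (nat \<Rightarrow> real) \<Rightarrow> ennreal"
    assume L: "(\<lambda>(x, z). L z x) \<in> borel_measurable (restrict_space borel (cube t) \<Otimes>\<^sub>M N)"
    have "(\<lambda>z. L z x) \<in> borel_measurable N" if "x \<in> V" for x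
      using measurable_compose[OF measurable_Pair1' L, of x] that vertices_subset_cube
      by (auto simp: space_restrict_space)
    then show "uniform_risk t N K L \<le> worst_risk t K L"
      by (intro uniform_risk_le_worst_risk measurable_XZ) simp
  qed
next
  show "ennreal (1/8 * h2_inv (max 0 (1 - B / real (t+2))))
       \<le> (INF (N', K', D) \<in> {(N' :: 'z measure, K', D).
             encoder t N' K' \<and> memory_information t N' K' \<le> B \<and> decoder t N' D}.
           worst_risk t K' (recovery_loss t D))"
  proof (rule INF_greatest, safe)
    fix N' :: "'z measure" and K' D
    assume "encoder t N' K'" "memory_information t N' K' \<le> B" "decoder t N' D"
    then show "ennreal (1/8 * h2_inv (max 0 (1 - B / real (t+2)))) \<le> worst_risk t K' (recovery_loss t D)"
      by (intro memory.worst_recovery_ge memory.intro)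
  qed
next
  show "ennreal (h2_inv (max 0 (1 - B / real (t+2))))
       \<le> (INF (N', K', \<delta>) \<in> {(N' :: 'z measure, K', \<delta>).
             encoder t N' K' \<and> memory_information t N' K' \<le> B \<and> decision_rule t N' \<delta>}.
           worst_risk t K' (decision_loss t \<delta>))"
  proof (rule INF_greatest, safe)
    fix N' :: "'z measure" and K' \<delta>
    assume "encoder t N' K'" "memory_information t N' K' \<le> B" "decision_rule t N' \<delta>"
    then show "ennreal (h2_inv (max 0 (1 - B / real (t+2)))) \<le> worst_risk t K' (decision_loss t \<delta>)"
      by (intro memory.worst_decision_ge memory.intro)
  qed
next
  show "\<forall>d E D. continuous_encoder t d E \<longrightarrow> d < t+2 \<longrightarrow> uniform_error t E D \<ge> 1/8"
    using uniform_error_ge by blast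
next
  show "requires_linear_memory 1 (\<lambda>t d. \<exists>E D. continuous_encoder t d E \<and> uniform_error t E D < 1/8)"
    unfolding requires_linear_memory_def
    using uniform_error_ge by (fastforce simp: not_less[symmetric])
next
  show "requires_linear_memory ((1 - h2 \<eta>) / b)
       (\<lambda>t d. \<exists>(C :: 'c list set) K' \<delta>.
         coordinate_implementation t d b C K' \<and> decision_rule t (count_space C) \<delta> \<and>
         average_decision_error t (count_space C) K' \<delta> \<le> \<eta>)"
    unfolding requires_linear_memory_def
    using h2_less_1[OF \<eta>] b coordinate_implementation_size[OF _ _ _ \<eta>(2) b] by auto
next
  show "requires_linear_memory ((1 - h2 \<eta>) / b)
       (\<lambda>t d. \<exists>(C :: 'c list set) K' \<delta>.
         coordinate_implementation t d b C K' \<and> decision_rule t (count_space C) \<delta> \<and>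
         worst_risk t K' (decision_loss t \<delta>) \<le> ennreal \<eta>)"
    unfolding requires_linear_memory_def
  proof (intro conjI allI impI)
    show "0 < (1 - h2 \<eta>) / b" using h2_less_1[OF \<eta>] b by simp
    fix s d :: nat
    assume "\<exists>(C :: 'c list set) K' \<delta>. coordinate_implementation s d b C K' \<and> decision_rule s (count_space C) \<delta> \<and>
         worst_risk s K' (decision_loss s \<delta>) \<le> ennreal \<eta>"
    then obtain C :: "'c list set" and K' \<delta> where impl: "coordinate_implementation s d b C K'"
      and \<delta>: "decision_rule s (count_space C) \<delta>" and risk: "worst_risk s K' (decision_loss s \<delta>) \<le> ennreal \<eta>" by blast
    interpret memory s "count_space C" K'
      by unfold_locales (use impl in \<open>auto simp: coordinate_implementation_def\<close>)
    have "ennreal (average_decision_error s (count_space C) K' \<delta>) \<le> ennreal \<eta>"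
      using uniform_risk_le_worst_risk[OF decision_loss_measurable[OF \<delta>]] risk
      by (simp only: uniform_risk_decision[OF \<delta>] order_trans)
    then show "(1 - h2 \<eta>) / b * real (s+2) \<le> real d"
      using \<eta> by (intro coordinate_implementation_size[OF impl \<delta> _ _ b]) (auto simp: ennreal_le_iff)
  qed
next
  show "requires_linear_memory ((1 - h2 (8 * \<epsilon>)) / b)
       (\<lambda>t d. \<exists>(C :: 'c list set) K' D.
         coordinate_implementation t d b C K' \<and> decoder t (count_space C) D \<and>
         uniform_risk t (count_space C) K' (recovery_loss t D) \<le> ennreal \<epsilon>)"
    unfolding requires_linear_memory_def
    using h2_less_1[of "8 * \<epsilon>"] b \<epsilon> coordinate_implementation_size_recovery[OF _ _ _ \<epsilon> b] by auto
next
  show "requires_linear_memory ((1 - h2 (8 * \<epsilon>)) / b)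
       (\<lambda>t d. \<exists>(C :: 'c list set) K' D.
         coordinate_implementation t d b C K' \<and> decoder t (count_space C) D \<and>
         worst_risk t K' (recovery_loss t D) \<le> ennreal \<epsilon>)"
    unfolding requires_linear_memory_def
  proof (intro conjI allI impI)
    show "0 < (1 - h2 (8 * \<epsilon>)) / b" using h2_less_1[of "8 * \<epsilon>"] \<epsilon> b by simp
    fix s d :: nat
    assume "\<exists>(C :: 'c list set) K' D. coordinate_implementation s d b C K' \<and> decoder s (count_space C) D \<and>
         worst_risk s K' (recovery_loss s D) \<le> ennreal \<epsilon>"
    then obtain C :: "'c list set" and K' D where impl: "coordinate_implementation s d b C K'"
      and D: "decoder s (count_space C) D" and risk: "worst_risk s K' (recovery_loss s D) \<le> ennreal \<epsilon>" by blast
    interpret memory s "count_space C" K'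
      by unfold_locales (use impl in \<open>auto simp: coordinate_implementation_def\<close>)
    have "uniform_risk s (count_space C) K' (recovery_loss s D) \<le> ennreal \<epsilon>"
      using uniform_risk_le_worst_risk[OF recovery_loss_measurable[OF D]] risk by (rule order_trans)
    then show "(1 - h2 (8 * \<epsilon>)) / b * real (s+2) \<le> real d"
      by (rule coordinate_implementation_size_recovery[OF impl D _ \<epsilon> b])
  qed
qed

end
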